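(* Let $(R,\mathfrak m)$ be an Arf local ring whose integral closure $\overline{R}$ is also a local ring. Define rings $A_i$ ($i\ge 0$) by $A_0=R$ and $A_i=A_{i-1}^{\mathfrak m_{i-1}}$ for $i>0$, where $\mathfrak m_i=\mathrm{J}(A_i)$ is the Jacobson radical of $A_i$ (so $\mathfrak m_0=\mathfrak m$); each $A_i$ is a local ring with maximal ideal $\mathfrak m_i$. Let $I\ne R$ be an integrally closed ideal of $R$ containing a non-zerodivisor on $R$, and let $q\ge 0$ be the integer such that $\{i\ge0\mid I_i\subsetneq R_{(I,i)}\}=\{0,1,\ldots,q\}$. Then $$I=\mathfrak m_0\mathfrak m_1\cdots\mathfrak m_q.$$
   Context: All rings are commutative. $\mathrm{Q}(R)$ is the total ring of fractions of $R$, $W(R)$ the set of non-zerodivisors on $R$, and $\overline{R}$ the integral closure of $R$ in $\mathrm{Q}(R)$. For an ideal $I$ of $R$, $\overline{I}$ is the integral closure of $I$ in $R$; $I$ is integrally closed if $\overline{I}=I$. For $R$-submodules $X,Y$ of $\mathrm{Q}(R)$, $X:Y=\{a\in \mathrm{Q}(R)\mid aY\subseteq X\}$. $\mathcal{X}_R$ denotes the set of integrally closed ideals of $R$ that contain a non-zerodivisor on $R$. Arf ring: a (Noetherian) Cohen-Macaulay semi-local ring $R$ of dimension one with $\dim R_M=1$ for every maximal ideal $M$, is called an Arf ring if (1) for every $I\in\mathcal{X}_R$ there is $a\in I$ with $I=\overline{aR}$ (that is, $I^{n+1}=aI^n$ for some $n\ge0$), and (2) if $x,y,z\in R$ with $x\in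 W(R)$ and $\frac{y}{x},\frac{z}{x}\in\overline{R}$, then $\frac{yz}{x}\in R$. For a ring $A$ and an ideal $\mathfrak a$ of $A$ containing a non-zerodivisor, $A^{\mathfrak a}=\bigcup_{n\ge0}(\mathfrak a^n:\mathfrak a^n)\subseteq\mathrm{Q}(A)$. The rings $R_{(I,n)}\subseteq\mathrm{Q}(R)$ and ideals $I_n$ of $R_{(I,n)}$ are defined recursively: $R_{(I,0)}=R$, $I_0=I$, and for $n>0$, $R_{(I,n)}=\sqrt{I_{n-1}}:\sqrt{I_{n-1}}$ and $I_n=I_{n-1}:\sqrt{I_{n-1}}$, where $\sqrt{I_{n-1}}$ is the radical of $I_{n-1}$ in $R_{(I,n-1)}$ and colons are taken in $\mathrm{Q}(R)$. The set $\{i\ge0\mid I_i\subsetneq R_{(I,i)}\}$ is finite and is an initial segment of the non-negative integers; it contains $0$ since $I\ne R$. Products of ideals of the different rings $A_i$ are sets of finite sums of products in $\mathrm{Q}(R)$. *)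

theory Defs
  imports "HOL-Algebra.Subrings" "HOL-Algebra.Ideal_Product" "HOL-Algebra.Ring_Divisibility"
     "HOL-Library.Extended_Nat"
begin

section \<open>Intrinsic notions for a commutative ring\<close>

definition nonzerodivisors :: "('a, 'm) ring_scheme \<Rightarrow> 'a set" where
  "nonzerodivisors A = {x \<in> carrier A. \<forall>y \<in> carrier A. x \<otimes>\<^bsub>A\<^esub> y = \<zero>\<^bsub>A\<^esub> \<longrightarrow> y = \<zero>\<^bsub>A\<^esub>}"

text \<open>No Noetherian condition is part of being local.\<close>

definition local_ring :: "('a, 'm) ring_scheme \<Rightarrow> bool" where
  "local_ring A \<longleftrightarrow> cring A \<and> (\<exists>!M. maximalideal M A)"

definition semilocal_ring :: "('a, 'm) ring_scheme \<Rightarrow> bool" where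
  "semilocal_ring A \<longleftrightarrow> cring A \<and> finite {M. maximalideal M A}"

definition jacobson_radical :: "('a, 'm) ring_scheme \<Rightarrow> 'a set" where
  "jacobson_radical A = {x \<in> carrier A. \<forall>M. maximalideal M A \<longrightarrow> x \<in> M}"

definition ideal_radical :: "('a, 'm) ring_scheme \<Rightarrow> 'a set \<Rightarrow> 'a set" where
  "ideal_radical A I = {x \<in> carrier A. \<exists>n::nat. x [^]\<^bsub>A\<^esub> n \<in> I}"

primrec ideal_power :: "('a, 'm) ring_scheme \<Rightarrow> 'a set \<Rightarrow> nat \<Rightarrow> 'a set" where
  "ideal_power A I 0 = carrier A"
| "ideal_power A I (Suc n) = ideal_prod A (ideal_power A I n) I"

text \<open>\<open>x\<close> is integral over the ideal \<open>I\<close> if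
  \<open>x\<^sup>n + c\<^sub>1 x\<^bsup>n-1\<^esup> + \<dots> + c\<^sub>n = 0\<close> for some \<open>n > 0\<close> and \<open>c\<^sub>i \<in> I\<^sup>i\<close>.\<close>

definition ideal_closure :: "('a, 'm) ring_scheme \<Rightarrow> 'a set \<Rightarrow> 'a set" where
  "ideal_closure A I = {x \<in> carrier A. \<exists>(n::nat) c. n > 0 \<and>
     (\<forall>i \<in> {1..n}. c i \<in> ideal_power A I i) \<and>
     x [^]\<^bsub>A\<^esub> n \<oplus>\<^bsub>A\<^esub> (\<Oplus>\<^bsub>A\<^esub>i \<in> {1..n}. c i \<otimes>\<^bsub>A\<^esub> x [^]\<^bsub>A\<^esub> (n - i)) = \<zero>\<^bsub>A\<^esub>}"

text \<open>The set \<open>\<X>\<^sub>A\<close> of integrally closed ideals containing a non-zerodivisor.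
  The unit ideal belongs to it.\<close>

definition closed_regular_ideals :: "('a, 'm) ring_scheme \<Rightarrow> 'a set set" where
  "closed_regular_ideals A =
     {I. ideal I A \<and> ideal_closure A I = I \<and> I \<inter> nonzerodivisors A \<noteq> {}}"


section \<open>Localization, dimension and depth\<close>

definition frac_rel ::
  "('a, 'm) ring_scheme \<Rightarrow> 'a set \<Rightarrow> (('a \<times> 'a) \<times> ('a \<times> 'a)) set" where
  "frac_rel A S = {((a, s), (b, t)). a \<in> carrier A \<and> b \<in> carrier A \<and> s \<in> S \<and> t \<in> S \<and>
     (\<exists>u \<in> S. u \<otimes>\<^bsub>A\<^esub> (a \<otimes>\<^bsub>A\<^esub> t) = u \<otimes>\<^bsub>A\<^esub> (b \<otimes>\<^bsub>A\<^esub> s))}"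

definition localization :: "('a, 'm) ring_scheme \<Rightarrow> 'a set \<Rightarrow> ('a \<times> 'a) set ring" where
  "localization A S =
    \<lparr>carrier = (carrier A \<times> S) // frac_rel A S,
     monoid.mult = (\<lambda>F G. \<Union>(a, s) \<in> F. \<Union>(b, t) \<in> G.
               frac_rel A S `` {(a \<otimes>\<^bsub>A\<^esub> b, s \<otimes>\<^bsub>A\<^esub> t)}),
     one = frac_rel A S `` {(\<one>\<^bsub>A\<^esub>, \<one>\<^bsub>A\<^esub>)},
     zero = frac_rel A S `` {(\<zero>\<^bsub>A\<^esub>, \<one>\<^bsub>A\<^esub>)},
     add = (\<lambda>F G. \<Union>(a, s) \<in> F. \<Union>(b, t) \<in> G.
               frac_rel A S `` {((a \<otimes>\<^bsub>A\<^esub> t) \<oplus>\<^bsub>A\<^esub> (b \<otimes>\<^bsub>A\<^esub> s), s \<otimes>\<^bsub>A\<^esub> t)})\<rparr>"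

abbreviation localization_at :: "('a, 'm) ring_scheme \<Rightarrow> 'a set \<Rightarrow> ('a \<times> 'a) set ring" where
  "localization_at A P \<equiv> localization A (carrier A - P)"

text \<open>The zero ring gets dimension \<open>0\<close> here, as \<open>Sup {} = 0\<close> in \<^typ>\<open>enat\<close>.\<close>

definition krull_dim :: "('a, 'm) ring_scheme \<Rightarrow> enat" where
  "krull_dim A = Sup {enat n | n. \<exists>P :: nat \<Rightarrow> 'a set.
     (\<forall>i \<le> n. primeideal (P i) A) \<and> (\<forall>i < n. P i \<subset> P (Suc i))}"

definition regular_sequence :: "('a, 'm) ring_scheme \<Rightarrow> 'a list \<Rightarrow> bool" where
  "regular_sequence A xs \<longleftrightarrow> set xs \<subseteq> carrier A \<and> genideal A (set xs) \<noteq> carrier A \<and>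
     (\<forall>i < length xs. \<forall>y \<in> carrier A.
        xs ! i \<otimes>\<^bsub>A\<^esub> y \<in> genideal A (set (take i xs)) \<longrightarrow> y \<in> genideal A (set (take i xs)))"

text \<open>Used for Noetherian local rings only, where the Jacobson radical is the maximal ideal.\<close>

definition depth :: "('a, 'm) ring_scheme \<Rightarrow> enat" where
  "depth A = Sup {enat (length xs) | xs. regular_sequence A xs \<and> set xs \<subseteq> jacobson_radical A}"

definition cohen_macaulay :: "('a, 'm) ring_scheme \<Rightarrow> bool" where
  "cohen_macaulay A \<longleftrightarrow> cring A \<and> noetherian_ring A \<and>
     (\<forall>M. maximalideal M A \<longrightarrow> depth (localization_at A M) = krull_dim (localization_at A M))"


section \<open>Rings inside a total ring of fractions\<close>

text \<open>From here on a ring \<open>R\<close> is a subset of the carrier of \<open>K = Q(R)\<close>; the ring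
  structure on it is \<open>subring_of K R\<close>. The predicate \<open>total_ring_of_fractions K R\<close>
  determines \<open>K\<close> up to a unique isomorphism over \<open>R\<close>.\<close>

abbreviation subring_of :: "('a, 'm) ring_scheme \<Rightarrow> 'a set \<Rightarrow> ('a, 'm) ring_scheme" where
  "subring_of K R \<equiv> K\<lparr>carrier := R\<rparr>"

definition total_ring_of_fractions :: "('a, 'm) ring_scheme \<Rightarrow> 'a set \<Rightarrow> bool" where
  "total_ring_of_fractions K R \<longleftrightarrow> cring K \<and> subring R K \<and>
     nonzerodivisors (subring_of K R) \<subseteq> Units K \<and>
     (\<forall>x \<in> carrier K. \<exists>a \<in> R. \<exists>w \<in> nonzerodivisors (subring_of K R). x = a \<otimes>\<^bsub>K\<^esub> inv\<^bsub>K\<^esub> w)"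

definition integral_closure :: "('a, 'm) ring_scheme \<Rightarrow> 'a set \<Rightarrow> 'a set" where
  "integral_closure K R = {x \<in> carrier K. \<exists>(n::nat) c. n > 0 \<and> (\<forall>i < n. c i \<in> R) \<and>
     x [^]\<^bsub>K\<^esub> n \<oplus>\<^bsub>K\<^esub> (\<Oplus>\<^bsub>K\<^esub>i \<in> {..<n}. c i \<otimes>\<^bsub>K\<^esub> x [^]\<^bsub>K\<^esub> i) = \<zero>\<^bsub>K\<^esub>}"

definition colon :: "('a, 'm) ring_scheme \<Rightarrow> 'a set \<Rightarrow> 'a set \<Rightarrow> 'a set" where
  "colon K U V = {a \<in> carrier K. \<forall>y \<in> V. a \<otimes>\<^bsub>K\<^esub> y \<in> U}"

definition arf_ring :: "('a, 'm) ring_scheme \<Rightarrow> 'a set \<Rightarrow> bool" where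
  "arf_ring K R \<longleftrightarrow>
     cohen_macaulay (subring_of K R) \<and> semilocal_ring (subring_of K R) \<and>
     krull_dim (subring_of K R) = 1 \<and>
     (\<forall>M. maximalideal M (subring_of K R) \<longrightarrow>
        krull_dim (localization_at (subring_of K R) M) = 1) \<and>
     (\<forall>I \<in> closed_regular_ideals (subring_of K R). \<exists>a \<in> I.
        I = ideal_closure (subring_of K R) (genideal (subring_of K R) {a})) \<and>
     (\<forall>x \<in> nonzerodivisors (subring_of K R). \<forall>y \<in> R. \<forall>z \<in> R.
        y \<otimes>\<^bsub>K\<^esub> inv\<^bsub>K\<^esub> x \<in> integral_closure K R \<longrightarrow>
        z \<otimes>\<^bsub>K\<^esub> inv\<^bsub>K\<^esub> x \<in> integral_closure K R \<longrightarrow>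
        (y \<otimes>\<^bsub>K\<^esub> z) \<otimes>\<^bsub>K\<^esub> inv\<^bsub>K\<^esub> x \<in> R)"

text \<open>\<open>A\<^bsup>\<aa>\<^esup> = \<Union>\<^sub>n (\<aa>\<^sup>n : \<aa>\<^sup>n)\<close>. The colon is taken in \<open>K\<close>, which is \<open>Q(A)\<close>
  whenever \<open>R \<subseteq> A \<subseteq> K = Q(R)\<close>.\<close>

definition blowup_ring :: "('a, 'm) ring_scheme \<Rightarrow> 'a set \<Rightarrow> 'a set \<Rightarrow> 'a set" where
  "blowup_ring K A \<aa> =
     (\<Union>n. colon K (ideal_power (subring_of K A) \<aa> n) (ideal_power (subring_of K A) \<aa> n))"

primrec blowup_seq :: "('a, 'm) ring_scheme \<Rightarrow> 'a set \<Rightarrow> nat \<Rightarrow> 'a set" where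
  "blowup_seq K R 0 = R"
| "blowup_seq K R (Suc i) =
     blowup_ring K (blowup_seq K R i) (jacobson_radical (subring_of K (blowup_seq K R i)))"

abbreviation blowup_rad :: "('a, 'm) ring_scheme \<Rightarrow> 'a set \<Rightarrow> nat \<Rightarrow> 'a set" where
  "blowup_rad K R i \<equiv> jacobson_radical (subring_of K (blowup_seq K R i))"

text \<open>The pair \<open>(R\<^bsub>(I,n)\<^esub>, I\<^sub>n)\<close>.\<close>

primrec ring_ideal_seq ::
  "('a, 'm) ring_scheme \<Rightarrow> 'a set \<Rightarrow> 'a set \<Rightarrow> nat \<Rightarrow> 'a set \<times> 'a set" where
  "ring_ideal_seq K R I 0 = (R, I)"
| "ring_ideal_seq K R I (Suc n) =
     (let (A, J) = ring_ideal_seq K R I n; rad = ideal_radical (subring_of K A) J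
      in (colon K rad rad, colon K J rad))"

abbreviation ring_seq :: "('a, 'm) ring_scheme \<Rightarrow> 'a set \<Rightarrow> 'a set \<Rightarrow> nat \<Rightarrow> 'a set" where
  "ring_seq K R I n \<equiv> fst (ring_ideal_seq K R I n)"

abbreviation ideal_seq :: "('a, 'm) ring_scheme \<Rightarrow> 'a set \<Rightarrow> 'a set \<Rightarrow> nat \<Rightarrow> 'a set" where
  "ideal_seq K R I n \<equiv> snd (ring_ideal_seq K R I n)"

text \<open>\<open>iterated_prod K M q = M 0 \<cdot> M 1 \<cdot> \<dots> \<cdot> M q\<close>, with products of additive subgroups of
  \<open>K\<close>, i.e.\ finite sums of products.\<close>

primrec iterated_prod :: "('a, 'm) ring_scheme \<Rightarrow> (nat \<Rightarrow> 'a set) \<Rightarrow> nat \<Rightarrow> 'a set" where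
  "iterated_prod K M 0 = M 0"
| "iterated_prod K M (Suc q) = ideal_prod K (iterated_prod K M q) (M (Suc q))"

end

theory Submission
  imports Defs
begin

text \<open>Let \<open>B\<close> be the integral closure of \<open>R\<close> and \<open>N\<close> its maximal ideal. For a unit \<open>t\<close> of \<open>K\<close> in
  \<open>R\<close> put \<open>A\<^sub>t = {z \<in> B. t z \<in> R}\<close>, which is a ring by the second Arf condition. If \<open>t A\<^sub>t\<close> is integrally
  closed in \<open>R\<close>, then so is \<open>t (A\<^sub>t \<inter> N)\<close>. By the first Arf condition this ideal is the closure of some
  \<open>t b R\<close>, and the maximal ideal \<open>A\<^sub>t \<inter> N\<close> of \<open>A\<^sub>t\<close> equals \<open>b A\<^bsub>tb\<^esub>\<close>; hence \<open>A\<^bsub>tb\<^esub>\<close> is the blowup of \<open>A\<^sub>t\<close>.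
  Starting from \<open>t\<^sub>0 = 1\<close> one gets the rings \<open>A\<^sub>i\<close> of the theorem, with \<open>t\<^bsub>i+1\<^esub> = t\<^sub>i b\<^sub>i\<close> and
  \<open>\<mm>\<^sub>0 \<cdot> \<dots> \<cdot> \<mm>\<^sub>q = t\<^bsub>q+1\<^esub> A\<^bsub>q+1\<^esub>\<close>. On the other hand \<open>I = xB \<inter> R\<close> for some \<open>x\<close>. As long as \<open>I\<^sub>i\<close> is proper, its
  radical in \<open>A\<^sub>i\<close> is \<open>\<mm>\<^sub>i\<close> because \<open>R\<close> has dimension one, so \<open>I\<^bsub>i+1\<^esub> = t\<^bsub>i+1\<^esub>\<^sup>-\<^sup>1 I\<close>. The process stops
  with \<open>I\<^bsub>q+1\<^esub> = A\<^bsub>q+1\<^esub>\<close>, that is, \<open>I = t\<^bsub>q+1\<^esub> A\<^bsub>q+1\<^esub>\<close>.\<close>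


section \<open>Prime and maximal ideals\<close>

text \<open>Zorn's lemma on the ideals that contain \<open>J\<close> and avoid \<open>S\<close>. The
  set \<open>S\<close> is arbitrary here: a multiplicative set leads to primes,
  \<open>{\<one>}\<close> to maximal ideals.\<close>

lemma (in cring) ideal_maximal_disjoint:
  assumes J: "ideal J R" and JS: "J \<inter> S = {}"
  obtains P where "ideal P R" "J \<subseteq> P" "P \<inter> S = {}"
    "\<And>Q. ideal Q R \<Longrightarrow> P \<subseteq> Q \<Longrightarrow> Q \<inter> S = {} \<Longrightarrow> Q = P"
proof -
  define \<A> where "\<A> = {Q. ideal Q R \<and> J \<subseteq> Q \<and> Q \<inter> S = {}}"
  have "\<exists>M\<in>\<A>. \<forall>X\<in>\<A>. M \<subseteq> X \<longrightarrow> X = M"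
  proof (rule subset_Zorn_nonempty)
    show "\<A> \<noteq> {}" using J JS by (auto simp: \<A>_def)
    fix \<C> assume C: "\<C> \<noteq> {}" "subset.chain \<A> \<C>"
    have sub: "\<C> \<subseteq> \<A>" using C(2) by (simp add: pred_on.chain_def)
    have "subset.chain {I. ideal I R} \<C>"
      using C(2) unfolding pred_on.chain_def \<A>_def by blast
    then have "ideal (\<Union>\<C>) R"
      using chain_Union_is_ideal[of \<C>] C(1) by simp
    moreover have "J \<subseteq> \<Union>\<C>" using sub C(1) unfolding \<A>_def by blast
    moreover have "\<Union>\<C> \<inter> S = {}" using sub unfolding \<A>_def by blast
    ultimately show "\<Union>\<C> \<in> \<A>" by (simp add: \<A>_def)
  qed
  then obtain P where P: "P \<in> \<A>" "\<And>X. X \<in> \<A> \<Longrightarrow> P \<subseteq> X \<Longrightarrow> X = P" by auto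
  have P': "ideal P R" "J \<subseteq> P" "P \<inter> S = {}" using P(1) by (simp_all add: \<A>_def)
  show thesis
  proof (rule that[OF P'])
    fix Q assume "ideal Q R" "P \<subseteq> Q" "Q \<inter> S = {}"
    then show "Q = P" using P(2)[of Q] P'(2) by (auto simp: \<A>_def)
  qed
qed

text \<open>By maximality, for \<open>a\<close> and \<open>b\<close> outside \<open>P\<close> both
  \<open>P + (a)\<close> and \<open>P + (b)\<close> meet \<open>S\<close>. The product of the two
  elements found lies in \<open>S\<close>, and in \<open>P\<close> as soon as
  \<open>a \<otimes> b\<close> does.\<close>

lemma (in cring) primeideal_disjoint:
  assumes J: "ideal J R" and JS: "J \<inter> S = {}" and S: "S \<subseteq> carrier R" "\<one> \<in> S"
    and S_mult: "\<And>s t. s \<in> S \<Longrightarrow> t \<in> S \<Longrightarrow> s \<otimes> t \<in> S"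
  obtains P where "primeideal P R" "J \<subseteq> P" "P \<inter> S = {}"
proof -
  obtain P where P: "ideal P R" "J \<subseteq> P" "P \<inter> S = {}"
    and max: "\<And>Q. ideal Q R \<Longrightarrow> P \<subseteq> Q \<Longrightarrow> Q \<inter> S = {} \<Longrightarrow> Q = P"
    using ideal_maximal_disjoint[OF J JS] by metis
  interpret P: ideal P R by fact
  have meets: "\<exists>p\<in>P. \<exists>x\<in>carrier R. p \<oplus> x \<otimes> a \<in> S" if a: "a \<in> carrier R" "a \<notin> P" for a
  proof (rule ccontr)
    assume neg: "\<not> ?thesis"
    let ?Q = "P <+>\<^bsub>R\<^esub> PIdl a"
    have Q: "ideal ?Q R" using add_ideals[OF P(1) cgenideal_ideal[OF a(1)]] .
    have mem: "u \<in> ?Q \<longleftrightarrow> (\<exists>p\<in>P. \<exists>x\<in>carrier R. u = p \<oplus> x \<otimes> a)" for u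
      by (auto simp: set_add_def' cgenideal_def)
    have "P \<subseteq> ?Q"
    proof
      fix p assume "p \<in> P"
      then have "p = p \<oplus> \<zero> \<otimes> a" using a P.Icarr by simp
      then show "p \<in> ?Q" using mem \<open>p \<in> P\<close> by blast
    qed
    moreover have "?Q \<inter> S = {}"
    proof (rule equals0I)
      fix u assume "u \<in> ?Q \<inter> S"
      then show False using neg mem[of u] by blast
    qed
    ultimately have "?Q = P" using max Q by blast
    moreover have "a = \<zero> \<oplus> \<one> \<otimes> a" using a by simp
    then have "a \<in> ?Q" using mem P.zero_closed by blast
    ultimately show False using a by blast
  qed
  have "primeideal P R"
  proof (rule primeidealI)
    show "ideal P R" "cring R" by (fact P is_cring)+
    show "carrier R \<noteq> P" using P(3) S by auto
    fix a b assume ab: "a \<in> carrier R" "b \<in> carrier R" "a \<otimes> b \<in> P"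
    show "a \<in> P \<or> b \<in> P"
    proof (rule ccontr)
      assume "\<not> ?thesis"
      then obtain p x q y where pq: "p \<in> P" "x \<in> carrier R" "p \<oplus> x \<otimes> a \<in> S"
        "q \<in> P" "y \<in> carrier R" "q \<oplus> y \<otimes> b \<in> S" using meets ab by metis
      have pqc: "p \<in> carrier R" "q \<in> carrier R" using pq P.Icarr by auto
      have "(p \<oplus> x \<otimes> a) \<otimes> (q \<oplus> y \<otimes> b)
          = p \<otimes> (q \<oplus> y \<otimes> b) \<oplus> ((x \<otimes> a) \<otimes> q \<oplus> (x \<otimes> y) \<otimes> (a \<otimes> b))"
        using ab pq pqc by algebra
      also have "\<dots> \<in> P"
      proof (intro P.a_closed)
        show "p \<otimes> (q \<oplus> y \<otimes> b) \<in> P" using ab pq pqc by (intro P.I_r_closed) auto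
        show "(x \<otimes> a) \<otimes> q \<in> P" using ab pq pqc by (intro P.I_l_closed) auto
        show "(x \<otimes> y) \<otimes> (a \<otimes> b) \<in> P" using pq by (intro P.I_l_closed[OF ab(3)]) auto
      qed
      finally show False using S_mult pq P(3) by blast
    qed
  qed
  then show thesis using that P by blast
qed

text \<open>An ideal is proper iff it avoids \<open>\<one>\<close>, so an ideal maximal among those
  avoiding \<open>{\<one>}\<close> is a maximal ideal. The principal ideal of a nonunit is one to
  start from.\<close>

lemma (in cring) nonunit_in_maximalideal:
  assumes x: "x \<in> carrier R" "x \<notin> Units R"
  obtains M where "maximalideal M R" "x \<in> M"
proof -
  have "PIdl x \<inter> {\<one>} = {}"
  proof (rule ccontr)
    assume "PIdl x \<inter> {\<one>} \<noteq> {}"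
    then obtain y where "y \<in> carrier R" "y \<otimes> x = \<one>" by (auto simp: cgenideal_def)
    then show False using x m_comm[of x y] by (auto simp: Units_def)
  qed
  then obtain P where P: "ideal P R" "PIdl x \<subseteq> P" "P \<inter> {\<one>} = {}"
    and max: "\<And>Q. ideal Q R \<Longrightarrow> P \<subseteq> Q \<Longrightarrow> Q \<inter> {\<one>} = {} \<Longrightarrow> Q = P"
    using ideal_maximal_disjoint[OF cgenideal_ideal[OF x(1)]] by metis
  have "maximalideal P R"
  proof (rule maximalidealI)
    show "carrier R \<noteq> P" using P(3) by auto
    fix J assume J: "ideal J R" "P \<subseteq> J" "J \<subseteq> carrier R"
    show "J = P \<or> J = carrier R"
      using max[OF J(1,2)] ideal.one_imp_carrier[OF J(1)] by auto
  qed (fact P)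
  then show thesis using that P(2) cgenideal_self[OF x(1)] by blast
qed

section \<open>Non-zerodivisors and powers in principal ideals\<close>

lemma (in cring) nonzerodivisors_mult:
  assumes "s \<in> nonzerodivisors R" "t \<in> nonzerodivisors R"
  shows "s \<otimes> t \<in> nonzerodivisors R"
proof -
  have st: "s \<in> carrier R" "t \<in> carrier R" using assms by (simp_all add: nonzerodivisors_def)
  have "y = \<zero>" if y: "y \<in> carrier R" "(s \<otimes> t) \<otimes> y = \<zero>" for y
  proof -
    have "t \<otimes> y = \<zero>"
      using y st m_assoc[of s t y] assms(1) by (simp add: nonzerodivisors_def)
    then show ?thesis using y assms(2) by (simp add: nonzerodivisors_def)
  qed
  then show ?thesis using st by (simp add: nonzerodivisors_def)
qed

text \<open>A prime containing \<open>w\<close> but no power of \<open>z\<close> would lie strictly between \<open>M\<close> and a prime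
  consisting of zero divisors.\<close>

lemma (in cring) power_in_principal_if_krull_dim_le_one:
  assumes dim: "krull_dim R \<le> 1" and M: "primeideal M R" "\<And>P. primeideal P R \<Longrightarrow> P \<subseteq> M"
    and w: "w \<in> nonzerodivisors R" and z: "z \<in> M"
  shows "\<exists>n::nat. z [^] n \<in> PIdl w"
proof (rule ccontr)
  assume neg: "\<not> ?thesis"
  interpret M: primeideal M R by fact
  have zc: "z \<in> carrier R" and wc: "w \<in> carrier R"
    using z w M.Icarr by (auto simp: nonzerodivisors_def)
  let ?Z = "range (\<lambda>n::nat. z [^] n)"
  obtain P where P: "primeideal P R" "PIdl w \<subseteq> P" "P \<inter> ?Z = {}"
  proof (rule primeideal_disjoint)
    show "ideal (PIdl w) R" by (rule cgenideal_ideal[OF wc])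
    show "PIdl w \<inter> ?Z = {}" using neg by auto
    show "\<one> \<in> ?Z" by (rule range_eqI[of _ _ 0]) simp
    show "s \<otimes> t \<in> ?Z" if "s \<in> ?Z" "t \<in> ?Z" for s t
      using that zc by (auto simp: nat_pow_mult)
  qed (use zc in auto)
  interpret P: primeideal P R by fact
  \<comment> \<open>The multiplicative set generated by the complement of \<open>P\<close> and the
    non-zerodivisors. A prime \<open>Q\<close> disjoint from it lies in \<open>P\<close> (take
    \<open>v = \<one>\<close>) and contains no non-zerodivisor (take \<open>s = \<one>\<close>), so
    \<open>w\<close> separates \<open>Q\<close> from \<open>P\<close>.\<close>
  define S where "S = {s \<otimes> v |s v. s \<in> carrier R \<and> s \<notin> P \<and> v \<in> nonzerodivisors R}"
  have S_I: "s \<otimes> v \<in> S" if "s \<in> carrier R" "s \<notin> P" "v \<in> nonzerodivisors R" for s v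
    using that unfolding S_def by blast
  have S_E: "\<exists>s v. u = s \<otimes> v \<and> s \<in> carrier R \<and> s \<notin> P \<and> v \<in> nonzerodivisors R" if "u \<in> S" for u
    using that unfolding S_def by blast
  have one_nzd: "\<one> \<in> nonzerodivisors R" by (simp add: nonzerodivisors_def)
  have one_P: "\<one> \<notin> P" using P.I_notcarr P.one_imp_carrier by auto
  have nzd_c: "v \<in> nonzerodivisors R \<Longrightarrow> v \<in> carrier R" for v by (simp add: nonzerodivisors_def)
  obtain Q where Q: "primeideal Q R" "{\<zero>} \<subseteq> Q" "Q \<inter> S = {}"
  proof (rule primeideal_disjoint)
    show "ideal {\<zero>} R" by (rule zeroideal)
    show "{\<zero>} \<inter> S = {}"
    proof (rule equals0I)
      fix u assume "u \<in> {\<zero>} \<inter> S"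
      then obtain s v where sv: "s \<in> carrier R" "s \<notin> P" "v \<in> nonzerodivisors R" "s \<otimes> v = \<zero>"
        using S_E[of u] by auto
      then have "v \<otimes> s = \<zero>" using m_comm[of s v] nzd_c by simp
      then have "s = \<zero>" using sv(1,3) unfolding nonzerodivisors_def by blast
      then show False using sv(2) P.zero_closed by simp
    qed
    have "\<one> \<otimes> \<one> \<in> S" using one_nzd one_P by (intro S_I) auto
    then show "\<one> \<in> S" by simp
    show "s \<otimes> t \<in> S" if ss: "s \<in> S" "t \<in> S" for s t
    proof -
      obtain a v b u where st: "s = a \<otimes> v" "t = b \<otimes> u" "a \<in> carrier R" "a \<notin> P" "b \<in> carrier R" "b \<notin> P"
        "v \<in> nonzerodivisors R" "u \<in> nonzerodivisors R"
        using S_E[OF ss(1)] S_E[OF ss(2)] by metis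
      have "s \<otimes> t = (a \<otimes> b) \<otimes> (v \<otimes> u)"
        using st nzd_c by (simp add: m_ac)
      moreover have "a \<otimes> b \<notin> P" using st P.I_prime[of a b] by auto
      ultimately show ?thesis using S_I[of "a \<otimes> b" "v \<otimes> u"] nonzerodivisors_mult st by simp
    qed
    show "S \<subseteq> carrier R" using nzd_c by (auto simp: S_def)
  qed
  have "Q \<subseteq> P"
  proof
    fix s assume s: "s \<in> Q"
    then have sc: "s \<in> carrier R" using ideal.Icarr[OF primeideal.axioms(1)[OF Q(1)]] by simp
    show "s \<in> P"
    proof (rule ccontr)
      assume "s \<notin> P"
      then have "s \<otimes> \<one> \<in> S" using sc one_nzd by (intro S_I)
      then show False using s sc Q(3) by auto
    qed
  qed
  moreover have "w \<in> P - Q"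
  proof -
    have "\<one> \<otimes> w \<in> S" using w one_P by (intro S_I) auto
    then show ?thesis using wc Q(3) P(2) cgenideal_self[OF wc] by auto
  qed
  ultimately have QP: "Q \<subset> P" by auto
  have "z \<notin> P" using P(3) zc nat_pow_eone[OF zc] by (metis disjoint_iff rangeI)
  then have PM: "P \<subset> M" using M(2)[OF P(1)] z by auto
  define C where "C = (\<lambda>n::nat. if n = 0 then Q else if n = 1 then P else M)"
  have "(\<forall>i\<le>2. primeideal (C i) R) \<and> (\<forall>i<2. C i \<subset> C (Suc i))"
    using P(1) Q(1) M(1) QP PM by (auto simp: C_def less_2_cases_iff)
  then have "enat 2 \<le> krull_dim R"
    unfolding krull_dim_def by (intro Sup_upper) auto
  then have "enat 2 \<le> enat 1" using dim unfolding one_enat_def by (rule order_trans)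
  then show False by simp
qed

section \<open>Monic polynomials and integral dependence\<close>

text \<open>The value at \<open>x\<close> of the monic polynomial of degree \<open>n\<close> whose
  coefficient at the power \<open>n - i\<close> is \<open>c i\<close>. The index is the weight used
  in \<open>ideal_closure\<close>, and the recursion splits off the constant coefficient, which
  permits induction on the degree.\<close>

primrec horner :: "('a, 'm) ring_scheme \<Rightarrow> 'a \<Rightarrow> (nat \<Rightarrow> 'a) \<Rightarrow> nat \<Rightarrow> 'a" where
  "horner R x c 0 = \<one>\<^bsub>R\<^esub>"
| "horner R x c (Suc n) = horner R x c n \<otimes>\<^bsub>R\<^esub> x \<oplus>\<^bsub>R\<^esub> c (Suc n)"

lemma horner_subring [simp]: "horner (subring_of K R) x c n = horner K x c n"
  by (induction n) auto

lemma horner_cong: "(\<And>i. i \<in> {1..n} \<Longrightarrow> c i = d i) \<Longrightarrow> horner R x c n = horner R x d n"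
  by (induction n) auto

context cring
begin

lemma horner_closed:
  "c \<in> {1..n} \<rightarrow> carrier R \<Longrightarrow> x \<in> carrier R \<Longrightarrow> horner R x c n \<in> carrier R"
  by (induction n) (auto simp: Pi_def)

lemma horner_eq_finsum:
  assumes "c \<in> {1..n} \<rightarrow> carrier R" "x \<in> carrier R"
  shows "x [^] n \<oplus> (\<Oplus>i\<in>{1..n}. c i \<otimes> x [^] (n - i)) = horner R x c n"
  using assms(1)
proof (induction n)
  case (Suc n)
  have c: "c i \<in> carrier R" if "i \<in> {1..Suc n}" for i using Suc.prems that by auto
  let ?s = "\<Oplus>i\<in>{1..n}. c i \<otimes> x [^] (n - i)"
  have s: "?s \<in> carrier R" using c assms(2) by (intro finsum_closed) auto
  have "(\<Oplus>i\<in>{1..Suc n}. c i \<otimes> x [^] (Suc n - i))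
      = c (Suc n) \<oplus> (\<Oplus>i\<in>{1..n}. c i \<otimes> x [^] (Suc n - i))"
    using c assms(2) by (subst atLeastAtMostSuc_conv) (auto intro!: finsum_insert[THEN trans])
  also have "(\<Oplus>i\<in>{1..n}. c i \<otimes> x [^] (Suc n - i)) = (\<Oplus>i\<in>{1..n}. c i \<otimes> x [^] (n - i) \<otimes> x)"
    using c assms(2) by (intro finsum_cong) (auto simp: Suc_diff_le m_assoc)
  also have "\<dots> = ?s \<otimes> x"
    using c assms(2) by (intro finsum_ldistr[symmetric]) auto
  finally have "x [^] Suc n \<oplus> (\<Oplus>i\<in>{1..Suc n}. c i \<otimes> x [^] (Suc n - i))
      = x [^] n \<otimes> x \<oplus> (c (Suc n) \<oplus> ?s \<otimes> x)" by simp
  also have "\<dots> = (x [^] n \<oplus> ?s) \<otimes> x \<oplus> c (Suc n)"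
    using c[of "Suc n"] s assms(2) by (simp add: l_distr a_ac)
  also have "x [^] n \<oplus> ?s = horner R x c n" using Suc c by auto
  finally show ?case by simp
qed simp

text \<open>In \<open>integral_closure\<close> a coefficient is indexed by its exponent, in
  \<open>horner\<close> by the complementary exponent; hence the reversal of the index.\<close>

lemma horner_eq_finsum_lessThan:
  assumes "\<And>i. i < n \<Longrightarrow> c i \<in> carrier R" "x \<in> carrier R"
  shows "x [^] n \<oplus> (\<Oplus>i\<in>{..<n}. c i \<otimes> x [^] i) = horner R x (\<lambda>i. c (n - i)) n"
proof -
  have img: "(\<lambda>i. n - i) ` {1..n} = {..<n}"
  proof
    show "{..<n} \<subseteq> (\<lambda>i. n - i) ` {1..n}"
      by (rule subsetI, rule_tac x = "n - x" in image_eqI) auto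
  qed auto
  have "(\<Oplus>i\<in>(\<lambda>i. n - i) ` {1..n}. c i \<otimes> x [^] i) = (\<Oplus>i\<in>{1..n}. c (n - i) \<otimes> x [^] (n - i))"
    using assms by (intro finsum_reindex) (auto simp: inj_on_def)
  then show ?thesis
    unfolding img using horner_eq_finsum[of "\<lambda>i. c (n - i)" n x] assms by auto
qed

text \<open>Homogeneity: if the \<open>i\<close>-th coefficient has weight \<open>i\<close> in
  \<open>t\<close>, replacing \<open>z\<close> by \<open>t \<otimes> z\<close> multiplies every term
  by \<open>t [^] n\<close>.\<close>

lemma horner_scale:
  assumes "t \<in> carrier R" "z \<in> carrier R" "e \<in> {1..n} \<rightarrow> carrier R"
    and "\<And>i. i \<in> {1..n} \<Longrightarrow> c i = t [^] i \<otimes> e i"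
  shows "horner R (t \<otimes> z) c n = t [^] n \<otimes> horner R z e n"
  using assms(3,4)
proof (induction n)
  case (Suc n)
  have e: "e (Suc n) \<in> carrier R" "e \<in> {1..n} \<rightarrow> carrier R" using Suc.prems by auto
  then have h: "horner R z e n \<in> carrier R" using assms by (intro horner_closed)
  have "horner R (t \<otimes> z) c n = t [^] n \<otimes> horner R z e n"
    by (rule Suc.IH) (use Suc.prems in auto)
  moreover have "c (Suc n) = t [^] n \<otimes> t \<otimes> e (Suc n)" using Suc.prems(2)[of "Suc n"] by simp
  ultimately show ?case
    using e h assms(1,2) by (simp add: r_distr m_ac)
qed simp

text \<open>All terms but the leading one lie in \<open>X\<close>. If the polynomial vanishes at
  \<open>x\<close>, a power of \<open>x\<close> is therefore the negative of an element of
  \<open>X\<close>; the applications are \<open>X = N\<close> and \<open>X = a <# R\<close>.\<close>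

lemma horner_minus_power:
  assumes X: "X \<subseteq> carrier R" "\<zero> \<in> X" "\<And>u v. u \<in> X \<Longrightarrow> v \<in> X \<Longrightarrow> u \<oplus> v \<in> X"
    "\<And>u. u \<in> X \<Longrightarrow> u \<otimes> x \<in> X"
    and x: "x \<in> carrier R" and c: "c \<in> {1..n} \<rightarrow> X"
  shows "\<exists>y\<in>X. horner R x c n = x [^] n \<oplus> y"
  using c
proof (induction n)
  case 0
  show ?case using X(2) by (intro bexI[of _ "\<zero>"]) auto
next
  case (Suc n)
  have "c \<in> {1..n} \<rightarrow> X" using Suc.prems by auto
  then obtain y where y: "y \<in> X" "horner R x c n = x [^] n \<oplus> y" using Suc.IH by blast
  have c: "c (Suc n) \<in> X" using Suc.prems by auto
  have "y \<in> carrier R" "c (Suc n) \<in> carrier R" using y c X by auto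
  then have "horner R x c (Suc n) = x [^] Suc n \<oplus> (y \<otimes> x \<oplus> c (Suc n))"
    using y x by (simp add: l_distr a_assoc)
  then show ?case using X y c by blast
qed

lemma mem_integral_closure_iff:
  assumes "S \<subseteq> carrier R"
  shows "x \<in> integral_closure R S \<longleftrightarrow>
    x \<in> carrier R \<and> (\<exists>n c. n > 0 \<and> c \<in> {1..n} \<rightarrow> S \<and> horner R x c n = \<zero>)" (is "_ \<longleftrightarrow> ?rhs")
proof
  assume "x \<in> integral_closure R S"
  then obtain n :: nat and c where x: "x \<in> carrier R" and nc: "n > 0" "\<forall>i<n. c i \<in> S"
    "x [^] n \<oplus> (\<Oplus>i\<in>{..<n}. c i \<otimes> x [^] i) = \<zero>"
    unfolding integral_closure_def by blast
  have c: "c i \<in> carrier R" if "i < n" for i using nc(2) that assms by blast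
  have "horner R x (\<lambda>i. c (n - i)) n = \<zero>"
    using horner_eq_finsum_lessThan[OF c x] nc(3) by simp
  moreover have "(\<lambda>i. c (n - i)) \<in> {1..n} \<rightarrow> S" using nc by auto
  ultimately show ?rhs using x nc(1) by blast
next
  assume ?rhs
  then obtain n c where x: "x \<in> carrier R" and nc: "n > 0" "c \<in> {1..n} \<rightarrow> S" "horner R x c n = \<zero>"
    by auto
  have c: "c (n - i) \<in> S" if "i < n" for i using nc(2) that by auto
  have "horner R x (\<lambda>i. c (n - (n - i))) n = horner R x c n"
    by (rule horner_cong) auto
  then have "x [^] n \<oplus> (\<Oplus>i\<in>{..<n}. c (n - i) \<otimes> x [^] i) = \<zero>"
    using horner_eq_finsum_lessThan[of n "\<lambda>i. c (n - i)" x] nc(3) x c assms by auto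
  then show "x \<in> integral_closure R S"
    unfolding integral_closure_def mem_Collect_eq using x nc(1) c
    by (intro conjI exI[of _ n] exI[of _ "\<lambda>i. c (n - i)"]) simp_all
qed

section \<open>Integral closure of ideals\<close>

lemma ideal_power_subset:
  assumes "J \<subseteq> carrier R"
  shows "ideal_power R J i \<subseteq> carrier R"
proof (induction i)
  case (Suc i)
  have "x \<in> carrier R" if "x \<in> ideal_prod R (ideal_power R J i) J" for x
    using that by induction (use Suc assms in auto)
  then show ?case by auto
qed simp

lemma mem_ideal_closure_iff:
  assumes "J \<subseteq> carrier R"
  shows "x \<in> ideal_closure R J \<longleftrightarrow> x \<in> carrier R \<and>
    (\<exists>n c. n > 0 \<and> (\<forall>i\<in>{1..n}. c i \<in> ideal_power R J i) \<and> horner R x c n = \<zero>)"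
proof -
  have "x [^] n \<oplus> (\<Oplus>i\<in>{1..n}. c i \<otimes> x [^] (n - i)) = horner R x c n"
    if "x \<in> carrier R" "\<forall>i\<in>{1..n}. c i \<in> ideal_power R J i" for n c
  proof (rule horner_eq_finsum)
    show "c \<in> {1..n} \<rightarrow> carrier R" using that(2) ideal_power_subset[OF assms] by (intro Pi_I) blast
  qed (fact that)
  note eq = this
  show ?thesis
  proof
    assume "x \<in> ideal_closure R J"
    then obtain n :: nat and c where "x \<in> carrier R" "n > 0" "\<forall>i\<in>{1..n}. c i \<in> ideal_power R J i"
      "x [^] n \<oplus> (\<Oplus>i\<in>{1..n}. c i \<otimes> x [^] (n - i)) = \<zero>"
      unfolding ideal_closure_def by blast
    then show "x \<in> carrier R \<and> (\<exists>n c. n > 0 \<and> (\<forall>i\<in>{1..n}. c i \<in> ideal_power R J i) \<and> horner R x c n = \<zero>)"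
      using eq[of n c] by (intro conjI exI[of _ n] exI[of _ c]) simp_all
  next
    assume "x \<in> carrier R \<and> (\<exists>n c. n > 0 \<and> (\<forall>i\<in>{1..n}. c i \<in> ideal_power R J i) \<and> horner R x c n = \<zero>)"
    then obtain n c where "x \<in> carrier R" "n > 0" "\<forall>i\<in>{1..n}. c i \<in> ideal_power R J i"
      "horner R x c n = \<zero>" by blast
    then show "x \<in> ideal_closure R J"
      unfolding ideal_closure_def mem_Collect_eq using eq[of n c]
      by (intro conjI exI[of _ n] exI[of _ c]) simp_all
  qed
qed

text \<open>The equation of degree one with coefficient \<open>\<ominus> x\<close> shows that
  \<open>x\<close> is integral over \<open>J\<close>.\<close>

lemma ideal_closure_superset:
  assumes "ideal J R"
  shows "J \<subseteq> ideal_closure R J"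
proof
  fix x assume x: "x \<in> J"
  interpret J: ideal J R by fact
  have xc: "x \<in> carrier R" using x J.Icarr by blast
  have "\<one> \<otimes> (\<ominus> x) \<in> ideal_power R J 1"
    unfolding One_nat_def ideal_power.simps
    by (rule ideal_prod.prod) (use J.a_inv_closed[OF x] in auto)
  then have "\<ominus> x \<in> ideal_power R J 1" using xc by simp
  moreover have "horner R x (\<lambda>_. \<ominus> x) 1 = \<zero>" using xc by (simp add: r_neg)
  ultimately show "x \<in> ideal_closure R J"
    unfolding mem_ideal_closure_iff[OF J.a_subset] using xc
    by (intro conjI exI[of _ 1] exI[of _ "\<lambda>_. \<ominus> x"]) auto
qed

end

lemma ideal_prod_mono: "I \<subseteq> I' \<Longrightarrow> J \<subseteq> J' \<Longrightarrow> ideal_prod R I J \<subseteq> ideal_prod R I' J'"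
proof
  fix x assume "I \<subseteq> I'" "J \<subseteq> J'" "x \<in> ideal_prod R I J"
  from this(3) show "x \<in> ideal_prod R I' J'"
    by induction (use \<open>I \<subseteq> I'\<close> \<open>J \<subseteq> J'\<close> in \<open>auto intro: ideal_prod.intros\<close>)
qed

lemma ideal_power_mono: "J \<subseteq> J' \<Longrightarrow> ideal_power R J i \<subseteq> ideal_power R J' i"
  by (induction i) (auto dest: ideal_prod_mono)

lemma ideal_closure_mono: "J \<subseteq> J' \<Longrightarrow> ideal_closure R J \<subseteq> ideal_closure R J'"
  using ideal_power_mono[of J J' R] unfolding ideal_closure_def by blast

section \<open>Subrings and their multiples\<close>

lemma mem_l_coset: "x \<in> t <#\<^bsub>R\<^esub> X \<longleftrightarrow> (\<exists>y\<in>X. x = t \<otimes>\<^bsub>R\<^esub> y)"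
  by (auto simp: l_coset_def)

lemma ideal_prod_subring [simp]: "ideal_prod (subring_of K A) X Y = ideal_prod K X Y"
proof
  have "x \<in> ideal_prod K X Y" if "x \<in> ideal_prod (subring_of K A) X Y" for x
    using that by induction (auto intro: ideal_prod.intros)
  then show "ideal_prod (subring_of K A) X Y \<subseteq> ideal_prod K X Y" by auto
  have "x \<in> ideal_prod (subring_of K A) X Y" if "x \<in> ideal_prod K X Y" for x
    using that
  proof induction
    case (prod i j)
    then show ?case using ideal_prod.prod[of i X j Y "subring_of K A"] by simp
  next
    case (sum s t)
    then show ?case using ideal_prod.sum[of s "subring_of K A" X Y t] by simp
  qed
  then show "ideal_prod K X Y \<subseteq> ideal_prod (subring_of K A) X Y" by auto
qed

text \<open>A proper ideal contains no unit and so lies in \<open>N\<close>.\<close>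

lemma (in cring) local_ringI:
  assumes N: "ideal N R" "\<one> \<notin> N" and units: "\<And>x. x \<in> carrier R \<Longrightarrow> x \<notin> N \<Longrightarrow> x \<in> Units R"
  shows "local_ring R" "maximalideal N R" "jacobson_radical R = N"
proof -
  have sub: "J \<subseteq> N" if J: "ideal J R" "J \<noteq> carrier R" for J
  proof
    fix x assume x: "x \<in> J"
    interpret J: ideal J R by fact
    show "x \<in> N"
    proof (rule ccontr)
      assume "x \<notin> N"
      then have "x \<in> Units R" using units x J.Icarr by blast
      then have "\<one> \<in> J" using J.I_l_closed[OF x Units_inv_closed] Units_l_inv by metis
      then show False using J(2) J.one_imp_carrier by simp
    qed
  qed
  have max: "maximalideal N R"
  proof (rule maximalidealI)
    show "carrier R \<noteq> N" using N(2) by auto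
    fix J assume "ideal J R" "N \<subseteq> J" "J \<subseteq> carrier R"
    then show "J = N \<or> J = carrier R" using sub by blast
  qed (fact N)
  have uniq: "M = N" if M: "maximalideal M R" for M
  proof -
    interpret M: maximalideal M R by fact
    have "M \<subseteq> N" using sub M.is_ideal M.I_notcarr by blast
    moreover have "N \<subseteq> carrier R" using ideal.Icarr[OF N(1)] by blast
    ultimately have "N = M \<or> N = carrier R" using M.I_maximal[OF N(1)] by blast
    then show ?thesis using N(2) by auto
  qed
  show "maximalideal N R" by (fact max)
  show "local_ring R" unfolding local_ring_def using max uniq is_cring by blast
  have "x \<in> carrier R" if "x \<in> N" for x using ideal.Icarr[OF N(1)] that by blast
  then show "jacobson_radical R = N"
    unfolding jacobson_radical_def using max uniq by blast
qed

lemma (in cring) local_ringE: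
  assumes "local_ring R"
  obtains N where "ideal N R" "\<one> \<notin> N" "\<And>x. x \<in> carrier R \<Longrightarrow> x \<notin> N \<Longrightarrow> x \<in> Units R"
proof -
  obtain N where N: "maximalideal N R" and uniq: "\<And>M. maximalideal M R \<Longrightarrow> M = N"
    using assms unfolding local_ring_def by blast
  interpret N: maximalideal N R by fact
  show thesis
  proof (rule that)
    show "ideal N R" by (fact N.is_ideal)
    show "\<one> \<notin> N" using N.one_imp_carrier N.I_notcarr by blast
    fix x assume "x \<in> carrier R" "x \<notin> N"
    then show "x \<in> Units R" using nonunit_in_maximalideal uniq by metis
  qed
qed

section \<open>Units and ideals of subrings\<close>

lemma (in cring) Units_subring:
  assumes "subring A R" "x \<in> Units (subring_of R A)"
  shows "x \<in> A" "x \<in> Units R" "inv x \<in> A"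
proof -
  obtain y where xy: "x \<in> A" "y \<in> A" "x \<otimes> y = \<one>" "y \<otimes> x = \<one>"
    using assms(2) by (auto simp: Units_def)
  have c: "x \<in> carrier R" "y \<in> carrier R" using xy subringE(1)[OF assms(1)] by auto
  show "x \<in> A" by fact
  show "x \<in> Units R" using xy c by (auto simp: Units_def)
  have "inv x = y" using inv_char[OF c] xy by simp
  then show "inv x \<in> A" using xy by simp
qed

lemma (in cring) UnitsI:
  assumes "x \<in> carrier R" "u \<in> carrier R" "x \<otimes> u = \<one>"
  shows "x \<in> Units R"
proof -
  have "u \<otimes> x = \<one>" using assms m_comm[of x u] by simp
  then show ?thesis unfolding Units_def using assms by blast
qed

lemma (in cring) Units_of_mult:
  assumes x: "x \<in> carrier R" and y: "y \<in> carrier R" and xy: "x \<otimes> y \<in> Units R"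
  shows "x \<in> Units R" "y \<in> Units R"
proof -
  let ?u = "inv (x \<otimes> y)"
  have u: "?u \<in> carrier R" using xy by simp
  have e: "(x \<otimes> y) \<otimes> ?u = \<one>" using xy by simp
  have "x \<otimes> (y \<otimes> ?u) = \<one>" using e x y u by (simp add: m_assoc)
  then show "x \<in> Units R" using x y u by (intro UnitsI[of x "y \<otimes> ?u"]) auto
  have "y \<otimes> (x \<otimes> ?u) = \<one>" using e x y u by (simp add: m_ac)
  then show "y \<in> Units R" using x y u by (intro UnitsI[of y "x \<otimes> ?u"]) auto
qed

lemma (in cring) Units_nonzerodivisor:
  assumes "subring A R" "x \<in> A" "x \<in> Units R"
  shows "x \<in> nonzerodivisors (subring_of R A)"
proof -
  have "y = \<zero>" if "y \<in> A" "x \<otimes> y = \<zero>" for y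
  proof -
    have "y \<in> carrier R" using that subringE(1)[OF assms(1)] by auto
    then have "inv x \<otimes> (x \<otimes> y) = y" using assms(3) m_assoc[of "inv x" x y] by (simp add: Units_closed)
    then show ?thesis using that assms(3) by simp
  qed
  then show ?thesis using assms by (simp add: nonzerodivisors_def)
qed

text \<open>Closure under negation comes from multiplication by \<open>\<ominus> \<one>\<close>,
  which lies in \<open>A\<close>.\<close>

lemma (in cring) ideal_subringI:
  assumes "subring A R" "I \<subseteq> A" "\<zero> \<in> I" "\<And>x y. x \<in> I \<Longrightarrow> y \<in> I \<Longrightarrow> x \<oplus> y \<in> I"
    and "\<And>a x. a \<in> A \<Longrightarrow> x \<in> I \<Longrightarrow> a \<otimes> x \<in> I"
  shows "ideal I (subring_of R A)"
proof -
  interpret A: cring "subring_of R A"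
    using subcring_iff[THEN iffD1, OF _ subcringI'] subringE(1) assms(1) by metis
  have Ac: "A \<subseteq> carrier R" by (rule subringE(1)[OF assms(1)])
  have mone: "\<ominus> \<one> \<in> A" using subringE(3,5)[OF assms(1)] by blast
  show ?thesis
  proof (rule idealI[OF A.ring_axioms])
    show "subgroup I (add_monoid (subring_of R A))"
    proof (rule A.add.subgroupI)
      show "I \<subseteq> carrier (subring_of R A)" "I \<noteq> {}" using assms by auto
      fix x assume x: "x \<in> I"
      have xc: "x \<in> A" "x \<in> carrier R" using x assms(2) Ac by auto
      have m: "\<ominus> \<one> \<otimes> x \<in> I" using assms(5) mone x by blast
      have "\<ominus> \<one> \<otimes> x \<oplus> x = \<zero>" using xc by (simp add: l_minus l_neg)
      then have "\<ominus>\<^bsub>subring_of R A\<^esub> x = \<ominus> \<one> \<otimes> x"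
        using A.minus_equality[of "\<ominus> \<one> \<otimes> x" x] m xc(1) assms(2) by auto
      then show "\<ominus>\<^bsub>subring_of R A\<^esub> x \<in> I" using m by simp
    next
      fix x y assume "x \<in> I" "y \<in> I"
      then show "x \<oplus>\<^bsub>subring_of R A\<^esub> y \<in> I" using assms(4) by simp
    qed
  next
    fix a x assume ax: "a \<in> I" "x \<in> carrier (subring_of R A)"
    then show "x \<otimes>\<^bsub>subring_of R A\<^esub> a \<in> I" using assms(5) by simp
    moreover have "a \<in> carrier R" "x \<in> carrier R" using ax assms(2) Ac by auto
    ultimately show "a \<otimes>\<^bsub>subring_of R A\<^esub> x \<in> I" using m_comm by simp
  qed
qed

lemma (in cring) ideal_subringE:
  assumes "ideal I (subring_of R A)"
  shows "I \<subseteq> A" "\<zero> \<in> I" "\<And>x y. x \<in> I \<Longrightarrow> y \<in> I \<Longrightarrow> x \<oplus> y \<in> I"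
    "\<And>a x. a \<in> A \<Longrightarrow> x \<in> I \<Longrightarrow> a \<otimes> x \<in> I"
proof -
  interpret I: ideal I "subring_of R A" by fact
  show "I \<subseteq> A" using I.a_subset by simp
  have "\<zero>\<^bsub>subring_of R A\<^esub> \<in> I"
    by (rule additive_subgroup.zero_closed[OF I.is_additive_subgroup])
  moreover have "\<zero>\<^bsub>subring_of R A\<^esub> = \<zero>" by simp
  ultimately show "\<zero> \<in> I" by metis
  show "x \<oplus> y \<in> I" if "x \<in> I" "y \<in> I" for x y using additive_subgroup.a_closed[OF I.is_additive_subgroup that] by simp
  show "a \<otimes> x \<in> I" if "a \<in> A" "x \<in> I" for a x using I.I_l_closed[of x a] that by simp
qed

section \<open>Products, colons and blowups of multiples of a subring\<close>

text \<open>The element \<open>\<one>\<close> of \<open>X\<close> already produces every multiple.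
  Allowing \<open>X\<close> to be smaller than \<open>A\<close> covers products of ideals that
  belong to different rings of a tower.\<close>

lemma (in cring) ideal_prod_scale:
  assumes A: "subring A R" and X: "X \<subseteq> A" "\<one> \<in> X" and cb: "c \<in> carrier R" "b \<in> carrier R"
  shows "ideal_prod R (c <# X) (b <# A) = (c \<otimes> b) <# A"
proof
  note A_simps = subringE[OF A]
  have Ac: "a \<in> A \<Longrightarrow> a \<in> carrier R" for a using A_simps(1) by auto
  have "x \<in> (c \<otimes> b) <# A" if "x \<in> ideal_prod R (c <# X) (b <# A)" for x
    using that
  proof induction
    case (prod i j)
    then obtain u v where uv: "u \<in> X" "v \<in> A" "i = c \<otimes> u" "j = b \<otimes> v" by (auto simp: mem_l_coset)
    then have "u \<in> A" using X by auto
    then have "i \<otimes> j = (c \<otimes> b) \<otimes> (u \<otimes> v)" "u \<otimes> v \<in> A"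
      using uv cb Ac A_simps(6) by (simp_all add: m_ac)
    then show ?case unfolding mem_l_coset by blast
  next
    case (sum s t)
    then obtain u v where uv: "u \<in> A" "v \<in> A" "s = (c \<otimes> b) \<otimes> u" "t = (c \<otimes> b) \<otimes> v"
      by (auto simp: mem_l_coset)
    then have "s \<oplus> t = (c \<otimes> b) \<otimes> (u \<oplus> v)" "u \<oplus> v \<in> A"
      using cb Ac A_simps(7) by (simp_all add: r_distr)
    then show ?case unfolding mem_l_coset by blast
  qed
  then show "ideal_prod R (c <# X) (b <# A) \<subseteq> (c \<otimes> b) <# A" by auto
  show "(c \<otimes> b) <# A \<subseteq> ideal_prod R (c <# X) (b <# A)"
  proof
    fix x assume "x \<in> (c \<otimes> b) <# A"
    then obtain v where v: "v \<in> A" "x = (c \<otimes> b) \<otimes> v" by (auto simp: mem_l_coset)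
    have "c \<otimes> \<one> \<in> c <# X" "b \<otimes> v \<in> b <# A" using X v unfolding mem_l_coset by blast+
    then have "(c \<otimes> \<one>) \<otimes> (b \<otimes> v) \<in> ideal_prod R (c <# X) (b <# A)" by (rule ideal_prod.prod)
    then show "x \<in> ideal_prod R (c <# X) (b <# A)" using v cb Ac by (simp add: m_assoc)
  qed
qed

lemma (in cring) colon_scale:
  assumes A: "subring A R" and c: "c \<in> Units R"
  shows "colon R (c <# A) (c <# A) = A"
proof
  note A_simps = subringE[OF A]
  have Ac: "a \<in> A \<Longrightarrow> a \<in> carrier R" for a using A_simps(1) by auto
  have cc: "c \<in> carrier R" using c by auto
  show "colon R (c <# A) (c <# A) \<subseteq> A"
  proof
    fix z assume z: "z \<in> colon R (c <# A) (c <# A)"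
    have zc: "z \<in> carrier R" using z by (simp add: colon_def)
    have "c \<otimes> \<one> \<in> c <# A" using A_simps(3) unfolding mem_l_coset by blast
    then have "z \<otimes> (c \<otimes> \<one>) \<in> c <# A" using z by (simp add: colon_def)
    then obtain v where v: "v \<in> A" "z \<otimes> (c \<otimes> \<one>) = c \<otimes> v" by (auto simp: mem_l_coset)
    then have "c \<otimes> z = c \<otimes> v" using zc cc by (simp add: m_comm)
    then have "z = v" using c zc Ac v by simp
    then show "z \<in> A" using v by simp
  qed
  show "A \<subseteq> colon R (c <# A) (c <# A)"
  proof
    fix z assume z: "z \<in> A"
    have "z \<otimes> y \<in> c <# A" if y: "y \<in> c <# A" for y
    proof -
      obtain v where v: "v \<in> A" "y = c \<otimes> v" using y by (auto simp: mem_l_coset)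
      then have "z \<otimes> y = c \<otimes> (z \<otimes> v)" using z cc Ac by (simp add: m_lcomm)
      then show ?thesis using z v A_simps(6) unfolding mem_l_coset by blast
    qed
    then show "z \<in> colon R (c <# A) (c <# A)" using z Ac by (simp add: colon_def)
  qed
qed

text \<open>The exponent is positive because the zeroth power is \<open>A\<close>, not
  \<open>A'\<close>.\<close>

lemma (in cring) ideal_power_scale:
  assumes A: "subring A R" "subring A' R" "A \<subseteq> A'" and b: "b \<in> carrier R"
  shows "ideal_power (subring_of R A) (b <# A') (Suc k) = (b [^] Suc k) <# A'"
proof (induction k)
  case 0
  have "\<one> <# A = A" using subringE(1)[OF A(1)] by (force simp: l_coset_def)
  then show ?case
    using ideal_prod_scale[of A' A \<one> b] A b subringE(3)[OF A(1)] by simp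
next
  case (Suc k)
  have "b [^] Suc k \<in> carrier R" using b by (rule nat_pow_closed)
  then show ?case
    using ideal_prod_scale[OF A(2) subset_refl subringE(3)[OF A(2)], of "b [^] Suc k" b] b
    unfolding ideal_power.simps(2)[of _ _ "Suc k"] Suc.IH by simp
qed

text \<open>The union is already reached at exponent one: each positive power of
  \<open>b <# A'\<close> is a multiple of \<open>A'\<close> by a unit of \<open>K\<close> and has
  colon \<open>A'\<close>, while exponent zero contributes a subset of \<open>A\<close>.\<close>

lemma (in cring) blowup_ring_scale:
  assumes A: "subring A R" "subring A' R" "A \<subseteq> A'" and b: "b \<in> Units R"
  shows "blowup_ring R A (b <# A') = A'"
proof -
  have col: "colon R (ideal_power (subring_of R A) (b <# A') (Suc k))
      (ideal_power (subring_of R A) (b <# A') (Suc k)) = A'" for k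
  proof -
    have "b [^] Suc k \<in> Units R" using b by (rule Units_pow_closed)
    then show ?thesis
      unfolding ideal_power_scale[OF A Units_closed[OF b]] by (rule colon_scale[OF A(2)])
  qed
  have "a \<in> A" if "a \<in> colon R A A" for a
  proof -
    have "a \<in> carrier R" "a \<otimes> \<one> \<in> A" using that subringE(3)[OF A(1)] by (auto simp: colon_def)
    then show ?thesis by simp
  qed
  then have col0: "colon R (ideal_power (subring_of R A) (b <# A') 0)
      (ideal_power (subring_of R A) (b <# A') 0) \<subseteq> A'" using A(3) by auto
  show ?thesis
  proof
    show "blowup_ring R A (b <# A') \<subseteq> A'"
      unfolding blowup_ring_def
    proof (rule UN_least)
      fix n show "colon R (ideal_power (subring_of R A) (b <# A') n)
        (ideal_power (subring_of R A) (b <# A') n) \<subseteq> A'"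
        using col0 col by (cases n) blast+
    qed
    show "A' \<subseteq> blowup_ring R A (b <# A')"
      unfolding blowup_ring_def using col[of 0] by blast
  qed
qed

section \<open>Arf local rings\<close>

text \<open>The last four assumptions unfold the locality of the integral closure: it is a ring, and
  \<open>N\<close> is a proper ideal whose complement consists of units.\<close>

locale arf_local = cring K for K :: "('a, 'm) ring_scheme" (structure) +
  fixes R N :: "'a set"
  assumes fractions: "total_ring_of_fractions K R"
    and arf: "arf_ring K R"
    and cring_closure: "cring (subring_of K (integral_closure K R))"
    and ideal_N: "ideal N (subring_of K (integral_closure K R))"
    and one_notin_N: "\<one> \<notin> N"
    and Units_closure: "\<And>x. x \<in> integral_closure K R \<Longrightarrow> x \<notin> N \<Longrightarrow>
      x \<in> Units (subring_of K (integral_closure K R))"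
begin

abbreviation B :: "'a set" where "B \<equiv> integral_closure K R"

lemma subring_R: "subring R K"
  using fractions by (simp add: total_ring_of_fractions_def)

lemma subring_B: "subring B K"
proof (rule ring_incl_imp_subring)
  show "B \<subseteq> carrier K" by (auto simp: integral_closure_def)
  show "ring (subring_of K B)" using cring_closure by (rule cring.axioms)
qed

lemmas R_simps = subringE(2,3,5,6,7)[OF subring_R] and B_simps = subringE(2,3,5,6,7)[OF subring_B]

lemma R_carrier: "x \<in> R \<Longrightarrow> x \<in> carrier K" and B_carrier: "x \<in> B \<Longrightarrow> x \<in> carrier K"
  using subringE(1)[OF subring_R] subringE(1)[OF subring_B] by auto

lemma cring_subring: "subring A K \<Longrightarrow> cring (subring_of K A)"
  using subcring_iff[THEN iffD1, OF _ subcringI'] subringE(1) by metis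

lemma cring_R: "cring (subring_of K R)"
  using cring_subring subring_R .

lemma mem_B_iff:
  "x \<in> B \<longleftrightarrow> x \<in> carrier K \<and> (\<exists>n c. n > 0 \<and> c \<in> {1..n} \<rightarrow> R \<and> horner K x c n = \<zero>)"
  by (rule mem_integral_closure_iff[OF subringE(1)[OF subring_R]])

lemma R_subset_B: "R \<subseteq> B"
proof
  fix x assume x: "x \<in> R"
  have "horner K x (\<lambda>_. \<ominus> x) 1 = \<zero>" using R_carrier[OF x] by (simp add: r_neg)
  then show "x \<in> B" unfolding mem_B_iff using R_carrier[OF x] R_simps(3)[OF x]
    by (intro conjI exI[of _ 1] exI[of _ "\<lambda>_. \<ominus> x"]) auto
qed

lemmas N_simps = ideal_subringE[OF ideal_N]

lemma N_B: "x \<in> N \<Longrightarrow> x \<in> B" and N_carrier: "x \<in> N \<Longrightarrow> x \<in> carrier K"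
  using N_simps(1) B_carrier by auto

lemma N_minus: "x \<in> N \<Longrightarrow> \<ominus> x \<in> N"
  using N_simps(4)[of "\<ominus> \<one>" x] B_simps(3)[OF B_simps(2)] N_carrier[of x] by (simp add: l_minus)

lemma unit_B: "x \<in> B \<Longrightarrow> x \<notin> N \<Longrightarrow> x \<in> Units K" "x \<in> B \<Longrightarrow> x \<notin> N \<Longrightarrow> inv x \<in> B"
  using Units_subring[OF subring_B Units_closure] by auto

text \<open>An element of \<open>B\<close> outside \<open>N\<close> is a unit of \<open>B\<close>,
  so factors can be cancelled one by one. Thus \<open>N\<close> is a radical ideal.\<close>

lemma power_notin_N:
  assumes "z \<in> B" "z \<notin> N"
  shows "z [^] (n::nat) \<notin> N"
proof (induction n)
  case 0
  show ?case using one_notin_N by simp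
next
  case (Suc n)
  have z: "z \<in> Units K" "inv z \<in> B" "z \<in> carrier K" using unit_B B_carrier assms by auto
  have "inv z \<otimes> z [^] Suc n = z [^] n"
    using z m_comm[of "z [^] n" z] m_assoc[of "inv z" z "z [^] n"] by simp
  then show ?case using N_simps(4)[OF z(2), of "z [^] Suc n"] Suc by auto
qed

lemma Units_if_nonzerodivisor: "x \<in> nonzerodivisors (subring_of K R) \<Longrightarrow> x \<in> R \<inter> Units K"
  using fractions by (auto simp: total_ring_of_fractions_def nonzerodivisors_def)

lemma nonzerodivisor_if_Units: "x \<in> R \<Longrightarrow> x \<in> Units K \<Longrightarrow> x \<in> nonzerodivisors (subring_of K R)"
  by (rule Units_nonzerodivisor[OF subring_R])

section \<open>The rings \<open>ext_ring t\<close>\<close>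

text \<open>The second Arf condition for \<open>t\<close>, \<open>t \<otimes> u\<close> and
  \<open>t \<otimes> v\<close>, whose quotients by \<open>t\<close> are the integral elements
  \<open>u\<close> and \<open>v\<close>.\<close>

lemma arf_mult:
  assumes t: "t \<in> R" "t \<in> Units K" and uv: "u \<in> B" "v \<in> B" "t \<otimes> u \<in> R" "t \<otimes> v \<in> R"
  shows "t \<otimes> (u \<otimes> v) \<in> R"
proof -
  have c: "t \<in> carrier K" "u \<in> carrier K" "v \<in> carrier K" "inv t \<in> carrier K"
    using t uv B_carrier by auto
  have e: "(t \<otimes> u) \<otimes> inv t = u" "(t \<otimes> v) \<otimes> inv t = v"
    using c t(2) m_comm[of t] by (simp_all add: m_assoc)
  have "((t \<otimes> u) \<otimes> (t \<otimes> v)) \<otimes> inv t = (t \<otimes> u) \<otimes> ((t \<otimes> v) \<otimes> inv t)"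
    using c by (simp add: m_assoc)
  also have "\<dots> = t \<otimes> (u \<otimes> v)" using e c by (simp add: m_assoc)
  finally have "((t \<otimes> u) \<otimes> (t \<otimes> v)) \<otimes> inv t = t \<otimes> (u \<otimes> v)" .
  moreover have "((t \<otimes> u) \<otimes> (t \<otimes> v)) \<otimes> inv t \<in> R"
    using arf uv e nonzerodivisor_if_Units[OF t] unfolding arf_ring_def by metis
  ultimately show ?thesis by simp
qed

text \<open>For a unit \<open>t\<close> of \<open>K\<close> in \<open>R\<close>, the set
  \<open>t <# ext_ring t\<close> is \<open>R \<inter> (t <# B)\<close>, the integral closure of the
  ideal \<open>t <# R\<close> by \<open>closure_principal\<close> below.\<close>

definition ext_ring :: "'a \<Rightarrow> 'a set" where
  "ext_ring t = {z \<in> B. t \<otimes> z \<in> R}"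

lemma ext_ring_subset: "ext_ring t \<subseteq> B" by (auto simp: ext_ring_def)

lemma ext_ring_one: "ext_ring \<one> = R"
  using R_subset_B R_carrier B_carrier by (auto simp: ext_ring_def)

context
  fixes t assumes t: "t \<in> R" "t \<in> Units K"
begin

lemma subset_ext_ring: "R \<subseteq> ext_ring t"
  using R_subset_B R_simps(4) t by (auto simp: ext_ring_def)

lemma subring_ext_ring: "subring (ext_ring t) K"
proof (rule subringI)
  have tc: "t \<in> carrier K" using t by auto
  show "ext_ring t \<subseteq> carrier K" using ext_ring_subset B_carrier by blast
  show "\<one> \<in> ext_ring t" using subset_ext_ring R_simps(2) by blast
  fix u assume u: "u \<in> ext_ring t"
  then have uB: "u \<in> B" "t \<otimes> u \<in> R" by (auto simp: ext_ring_def)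
  have "t \<otimes> \<ominus> u = \<ominus> (t \<otimes> u)" using tc uB B_carrier by (simp add: r_minus)
  then show "\<ominus> u \<in> ext_ring t" using uB B_simps R_simps by (simp add: ext_ring_def)
  fix v assume v: "v \<in> ext_ring t"
  then have vB: "v \<in> B" "t \<otimes> v \<in> R" by (auto simp: ext_ring_def)
  show "u \<otimes> v \<in> ext_ring t" using arf_mult[OF t] uB vB B_simps by (simp add: ext_ring_def)
  have "t \<otimes> (u \<oplus> v) = t \<otimes> u \<oplus> t \<otimes> v" using tc uB vB B_carrier by (simp add: r_distr)
  then show "u \<oplus> v \<in> ext_ring t" using uB vB B_simps R_simps by (simp add: ext_ring_def)
qed

end

section \<open>Rings between \<open>R\<close> and \<open>B\<close> are local\<close>

text \<open>An integral equation of \<open>inv z\<close>, multiplied by a power of \<open>z\<close>,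
  becomes \<open>\<one> \<oplus> z \<otimes> b = \<zero>\<close> with \<open>b\<close> in
  \<open>A\<close>; hence \<open>inv z = \<ominus> b\<close>.\<close>

lemma inv_in_subring:
  assumes A: "subring A K" "R \<subseteq> A" and z: "z \<in> A" "z \<in> Units K" "inv z \<in> B"
  shows "inv z \<in> A"
proof -
  note A_simps = subringE(2,3,5,6,7)[OF A(1)]
  have Ac: "a \<in> A \<Longrightarrow> a \<in> carrier K" for a using subringE(1)[OF A(1)] by auto
  let ?u = "inv z"
  have uc: "?u \<in> carrier K" and zc: "z \<in> carrier K" and uz: "?u \<otimes> z = \<one>" using z by auto
  obtain n c where nc: "n > 0" "c \<in> {1..n} \<rightarrow> R" "horner K ?u c n = \<zero>"
    using z(3) unfolding mem_B_iff by auto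
  \<comment> \<open>Clearing denominators: the factor \<open>z [^] n\<close> turns the leading term
    into \<open>\<one>\<close> and leaves at least one factor \<open>z\<close> in every other
    term.\<close>
  have "\<exists>b\<in>A. horner K ?u c n \<otimes> z [^] n = \<one> \<oplus> z \<otimes> b"
    using nc(2)
  proof (induction n)
    case 0
    show ?case using A_simps(1) zc by (intro bexI[of _ \<zero>]) auto
  next
    case (Suc n)
    have c: "c \<in> {1..n} \<rightarrow> R" "c (Suc n) \<in> R" using Suc.prems by auto
    then obtain b where b: "b \<in> A" "horner K ?u c n \<otimes> z [^] n = \<one> \<oplus> z \<otimes> b" using Suc.IH by auto
    have "c \<in> {1..n} \<rightarrow> carrier K" using c(1) R_carrier by auto
    then have h: "horner K ?u c n \<in> carrier K" using uc by (rule horner_closed)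
    have zA: "z [^] n \<in> A" using z(1) A_simps by (induction n) auto
    have cc: "c (Suc n) \<in> A" using c A(2) by auto
    have "horner K ?u c (Suc n) \<otimes> z [^] Suc n
        = horner K ?u c n \<otimes> z [^] n \<otimes> (?u \<otimes> z) \<oplus> z \<otimes> (z [^] n \<otimes> c (Suc n))"
      using h uc zc cc Ac by (simp add: l_distr r_distr m_ac)
    also have "\<dots> = \<one> \<oplus> z \<otimes> (b \<oplus> z [^] n \<otimes> c (Suc n))"
      using h b zc cc zA Ac uz by (simp add: r_distr a_assoc)
    finally show ?case using b zA cc A_simps by blast
  qed
  then obtain b where b: "b \<in> A" "\<zero> = \<one> \<oplus> z \<otimes> b" using nc zc by auto
  have bc: "b \<in> carrier K" using b Ac by auto
  have "?u \<otimes> (\<one> \<oplus> z \<otimes> b) = ?u \<oplus> b" using uc zc bc uz by (simp add: r_distr m_assoc[symmetric])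
  then have "?u \<oplus> b = \<zero>" using b(2)[symmetric] uc by simp
  then have "?u = \<ominus> b" using uc bc minus_equality by simp
  then show ?thesis using b A_simps by simp
qed

text \<open>An element of \<open>A\<close> outside \<open>N\<close> is a unit of \<open>B\<close>,
  and its inverse stays in \<open>A\<close> by \<open>inv_in_subring\<close>. So the maximal ideal
  is cut out by \<open>N\<close>, for \<open>R\<close> and for all rings of the tower alike.\<close>

lemma local_intermediate:
  assumes A: "subring A K" "R \<subseteq> A" "A \<subseteq> B"
  shows "local_ring (subring_of K A)" "maximalideal (A \<inter> N) (subring_of K A)"
    "jacobson_radical (subring_of K A) = A \<inter> N"
proof -
  interpret A: cring "subring_of K A" by (rule cring_subring[OF A(1)])
  have "ideal (A \<inter> N) (subring_of K A)"
    using subringE[OF A(1)] N_simps A(3) by (intro ideal_subringI[OF A(1)]) auto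
  moreover have "x \<in> Units (subring_of K A)" if x: "x \<in> A" "x \<notin> N" for x
  proof -
    have u: "x \<in> Units K" "inv x \<in> B" using unit_B x A(3) by auto
    then have "inv x \<in> A" using inv_in_subring[OF A(1,2)] x by blast
    then show ?thesis using x(1) u(1) by (intro A.UnitsI[of _ "inv x"]) auto
  qed
  ultimately show "local_ring (subring_of K A)" "maximalideal (A \<inter> N) (subring_of K A)"
    "jacobson_radical (subring_of K A) = A \<inter> N"
    using A.local_ringI[of "A \<inter> N"] one_notin_N by auto
qed

section \<open>Integral closure of ideals of \<open>R\<close>\<close>

text \<open>The set \<open>X\<close> may be \<open>N\<close>, which does not contain
  \<open>\<one>\<close>; so only positive exponents occur, the zeroth power being \<open>R\<close>
  itself.\<close>

lemma ideal_power_subset_scale: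
  assumes t: "t \<in> carrier K" and J: "J \<subseteq> t <# X"
    and X: "X \<subseteq> carrier K" "\<And>u v. u \<in> X \<Longrightarrow> v \<in> X \<Longrightarrow> u \<oplus> v \<in> X"
      "\<And>u v. u \<in> X \<Longrightarrow> v \<in> X \<Longrightarrow> u \<otimes> v \<in> X" "\<And>r v. r \<in> R \<Longrightarrow> v \<in> X \<Longrightarrow> r \<otimes> v \<in> X"
  shows "ideal_power (subring_of K R) J (Suc i) \<subseteq> (t [^] Suc i) <# X"
proof (induction i)
  case 0
  have "x \<in> t <# X" if "x \<in> ideal_prod K R J" for x
    using that
  proof induction
    case (prod r j)
    then have "j \<in> t <# X" using J by blast
    then obtain v where v: "v \<in> X" "j = t \<otimes> v" by (auto simp: mem_l_coset)
    then have "r \<otimes> j = t \<otimes> (r \<otimes> v)" using prod R_carrier X(1) t by (simp add: m_lcomm subset_eq)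
    then show ?case using v prod X(4) unfolding mem_l_coset by blast
  next
    case (sum x y)
    then obtain u v where uv: "u \<in> X" "x = t \<otimes> u" "v \<in> X" "y = t \<otimes> v" by (auto simp: mem_l_coset)
    then have "x \<oplus> y = t \<otimes> (u \<oplus> v)" using t X(1) by (simp add: r_distr subset_eq)
    then show ?case using uv X(2) unfolding mem_l_coset by blast
  qed
  then show ?case using t by auto
next
  case (Suc i)
  have "x \<in> t [^] Suc (Suc i) <# X" if "x \<in> ideal_prod K (ideal_power (subring_of K R) J (Suc i)) J" for x
    using that
  proof induction
    case (prod r j)
    then have "r \<in> t [^] Suc i <# X" "j \<in> t <# X" using J Suc.IH by blast+
    then obtain u v where u: "u \<in> X" "r = t [^] Suc i \<otimes> u" and v: "v \<in> X" "j = t \<otimes> v"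
      by (auto simp only: mem_l_coset)
    have "r \<otimes> j = t [^] Suc (Suc i) \<otimes> (u \<otimes> v)"
      using u v t X(1) by (simp add: m_ac subset_eq)
    then show ?case using u v X(3) unfolding mem_l_coset by blast
  next
    case (sum x y)
    then obtain u v where uv: "u \<in> X" "x = t [^] Suc (Suc i) \<otimes> u" "v \<in> X" "y = t [^] Suc (Suc i) \<otimes> v"
      by (auto simp only: mem_l_coset)
    have "x \<oplus> y = t [^] Suc (Suc i) \<otimes> (u \<oplus> v)"
      unfolding uv(2,4) using uv(1,3) X(1) by (intro r_distr[symmetric] nat_pow_closed[OF t]) auto
    then show ?case using uv X(2) unfolding mem_l_coset by blast
  qed
  then show ?case by auto
qed

lemma mem_closure_iff:
  assumes "J \<subseteq> R"
  shows "x \<in> ideal_closure (subring_of K R) J \<longleftrightarrow> x \<in> R \<and>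
    (\<exists>n c. n > 0 \<and> (\<forall>i\<in>{1..n}. c i \<in> ideal_power (subring_of K R) J i) \<and> horner K x c n = \<zero>)"
proof -
  interpret R: cring "subring_of K R" by (rule cring_R)
  show ?thesis using R.mem_ideal_closure_iff[of J x] assms by simp
qed

lemma closure_subset: "ideal_closure (subring_of K R) J \<subseteq> R"
  by (auto simp: ideal_closure_def)

text \<open>The equation of \<open>t \<otimes> z\<close> over \<open>J\<close> is divided by
  \<open>t [^] n\<close>. Its \<open>i\<close>-th coefficient lies in the \<open>i\<close>-th power
  of \<open>J\<close>, hence in \<open>t [^] i <# X\<close>, and leaves an element of
  \<open>X\<close>.\<close>

lemma closure_scale:
  assumes t: "t \<in> Units K" and J: "J \<subseteq> R" "J \<subseteq> t <# X"
    and X: "X \<subseteq> carrier K" "\<And>u v. u \<in> X \<Longrightarrow> v \<in> X \<Longrightarrow> u \<oplus> v \<in> X"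
      "\<And>u v. u \<in> X \<Longrightarrow> v \<in> X \<Longrightarrow> u \<otimes> v \<in> X" "\<And>r v. r \<in> R \<Longrightarrow> v \<in> X \<Longrightarrow> r \<otimes> v \<in> X"
    and x: "t \<otimes> z \<in> ideal_closure (subring_of K R) J" "z \<in> carrier K"
  shows "\<exists>n e. n > 0 \<and> e \<in> {1..n} \<rightarrow> X \<and> horner K z e n = \<zero>"
proof -
  have tc: "t \<in> carrier K" using t by auto
  obtain n c where nc: "n > 0" "\<forall>i\<in>{1..n}. c i \<in> ideal_power (subring_of K R) J i"
    "horner K (t \<otimes> z) c n = \<zero>" using x(1) unfolding mem_closure_iff[OF J(1)] by blast
  have "\<exists>e\<in>X. c i = t [^] i \<otimes> e" if i: "i \<in> {1..n}" for i
  proof -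
    obtain k where k: "i = Suc k" using i by (cases i) auto
    show ?thesis
      using ideal_power_subset_scale[OF tc J(2) X, of k] bspec[OF nc(2) i] unfolding k mem_l_coset[symmetric]
      by blast
  qed
  then obtain e where e: "\<And>i. i \<in> {1..n} \<Longrightarrow> e i \<in> X" "\<And>i. i \<in> {1..n} \<Longrightarrow> c i = t [^] i \<otimes> e i"
    by metis
  have eX: "e \<in> {1..n} \<rightarrow> X" "e \<in> {1..n} \<rightarrow> carrier K" using e X(1) by auto
  have h: "horner K z e n \<in> carrier K" by (rule horner_closed[OF eX(2) x(2)])
  have "t [^] n \<otimes> horner K z e n = \<zero>"
    using horner_scale[OF tc x(2) eX(2) e(2)] nc(3) by metis
  then have "t [^] n \<otimes> horner K z e n = t [^] n \<otimes> \<zero>" using tc by simp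
  then have "horner K z e n = \<zero>"
    using Units_l_cancel[OF Units_pow_closed[OF t] h zero_closed] by blast
  then show ?thesis using nc(1) eX(1) by blast
qed

lemma principal_ideal_eq:
  assumes "a \<in> R"
  shows "genideal (subring_of K R) {a} = a <# R" "ideal (a <# R) (subring_of K R)"
proof -
  interpret R: cring "subring_of K R" by (rule cring_R)
  have "cgenideal (subring_of K R) a = a <# R"
    using assms R_carrier m_comm by (auto simp: cgenideal_def l_coset_def)
  then show "genideal (subring_of K R) {a} = a <# R" "ideal (a <# R) (subring_of K R)"
    using R.cgenideal_eq_genideal[of a] R.cgenideal_ideal[of a] assms by auto
qed

lemma principal_subset: "a \<in> R \<Longrightarrow> a <# R \<subseteq> R"
  using R_simps(4) by (auto simp: l_coset_def)

text \<open>Scaling by \<open>a\<close> exchanges the equations of \<open>z\<close> over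
  \<open>R\<close> and those of \<open>a \<otimes> z\<close> over the ideal
  \<open>a <# R\<close>.\<close>

lemma closure_principal:
  assumes a: "a \<in> R" "a \<in> Units K"
  shows "ideal_closure (subring_of K R) (genideal (subring_of K R) {a}) = R \<inter> (a <# B)"
proof
  have ac: "a \<in> carrier K" using a by auto
  show "ideal_closure (subring_of K R) (genideal (subring_of K R) {a}) \<subseteq> R \<inter> (a <# B)"
  proof
    fix x assume x: "x \<in> ideal_closure (subring_of K R) (genideal (subring_of K R) {a})"
    then have xR: "x \<in> R" using closure_subset by blast
    let ?z = "inv a \<otimes> x"
    have z: "?z \<in> carrier K" "a \<otimes> ?z = x" using a R_carrier[OF xR] by (simp_all add: m_assoc[symmetric] ac)
    have "a \<otimes> ?z \<in> ideal_closure (subring_of K R) (a <# R)"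
      using x z principal_ideal_eq[OF a(1)] by simp
    then have "\<exists>n e. n > 0 \<and> e \<in> {1..n} \<rightarrow> R \<and> horner K ?z e n = \<zero>"
    proof (intro closure_scale[OF a(2) principal_subset[OF a(1)] subset_refl])
      show "R \<subseteq> carrier K" using R_carrier by blast
    qed (use R_simps z in auto)
    then have "?z \<in> B" unfolding mem_B_iff using z by blast
    then show "x \<in> R \<inter> (a <# B)"
      unfolding Int_iff mem_l_coset using xR z(2)[symmetric] by blast
  qed
  show "R \<inter> (a <# B) \<subseteq> ideal_closure (subring_of K R) (genideal (subring_of K R) {a})"
  proof
    fix x assume "x \<in> R \<inter> (a <# B)"
    then obtain z where x: "x \<in> R" "z \<in> B" "x = a \<otimes> z" by (auto simp: mem_l_coset)
    then obtain n c where nc: "n > 0" "c \<in> {1..n} \<rightarrow> R" "horner K z c n = \<zero>" "z \<in> carrier K"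
      unfolding mem_B_iff by auto
    have pow: "a [^] i \<otimes> r \<in> ideal_power (subring_of K R) (a <# R) i" if "r \<in> R" for i r
      using that
    proof (induction i arbitrary: r)
      case 0
      then show ?case using R_carrier by simp
    next
      case (Suc i)
      have "a \<otimes> \<one> \<in> a <# R" using R_simps(2) unfolding mem_l_coset by blast
      then have "a \<in> a <# R" using ac by simp
      then have "(a [^] i \<otimes> r) \<otimes> a \<in> ideal_power (subring_of K R) (a <# R) (Suc i)"
        using Suc by (auto intro: ideal_prod.prod)
      moreover have "(a [^] i \<otimes> r) \<otimes> a = a [^] Suc i \<otimes> r"
        using ac R_carrier[OF Suc.prems] by (simp add: m_ac)
      ultimately show ?case by simp
    qed
    have cK: "c \<in> {1..n} \<rightarrow> carrier K" using nc R_carrier by auto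
    have "horner K x (\<lambda>i. a [^] i \<otimes> c i) n = a [^] n \<otimes> horner K z c n"
      unfolding x(3) by (rule horner_scale[OF ac nc(4) cK]) simp
    then have "horner K x (\<lambda>i. a [^] i \<otimes> c i) n = \<zero>" using nc ac by simp
    moreover have "\<forall>i\<in>{1..n}. a [^] i \<otimes> c i \<in> ideal_power (subring_of K R) (a <# R) i"
      using pow nc(2) by auto
    ultimately show "x \<in> ideal_closure (subring_of K R) (genideal (subring_of K R) {a})"
      unfolding principal_ideal_eq[OF a(1)] mem_closure_iff[OF principal_subset[OF a(1)]]
      using x(1) nc(1) by (intro conjI exI[of _ n] exI[of _ "\<lambda>i. a [^] i \<otimes> c i"]) simp_all
  qed
qed

text \<open>All coefficients of the equation of \<open>w\<close> are multiples of \<open>a\<close>,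
  so a power of \<open>w\<close> is a multiple of \<open>a\<close>. That power is a unit of
  \<open>K\<close>, and so is its factor \<open>a\<close>.\<close>

lemma Units_if_regular_mem_closure:
  assumes a: "a \<in> R" and w: "w \<in> ideal_closure (subring_of K R) (genideal (subring_of K R) {a})"
    "w \<in> Units K"
  shows "a \<in> Units K"
proof -
  have ac: "a \<in> carrier K" using a R_carrier by auto
  have wR: "w \<in> R" using w closure_subset by blast
  obtain n c where nc: "n > 0" "\<forall>i\<in>{1..n}. c i \<in> ideal_power (subring_of K R) (a <# R) i"
    "horner K w c n = \<zero>"
    using w(1) unfolding principal_ideal_eq[OF a] mem_closure_iff[OF principal_subset[OF a]] by blast
  have c: "c \<in> {1..n} \<rightarrow> a <# R"
  proof
    fix i assume i: "i \<in> {1..n}"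
    then obtain k where k: "i = Suc k" by (cases i) auto
    have "c i \<in> a [^] Suc k <# R"
    proof (rule subsetD[OF ideal_power_subset_scale[OF ac subset_refl]])
      show "R \<subseteq> carrier K" using R_carrier by blast
      show "c i \<in> ideal_power (subring_of K R) (a <# R) (Suc k)" using bspec[OF nc(2) i] k by simp
    qed (use R_simps in auto)
    then obtain r where r: "r \<in> R" "c i = a [^] Suc k \<otimes> r" by (auto simp only: mem_l_coset)
    have "a [^] k \<in> R" using a R_simps by (induction k) auto
    moreover have "c i = a \<otimes> (a [^] k \<otimes> r)" using r ac R_carrier by (simp add: m_ac)
    ultimately show "c i \<in> a <# R" using r R_simps unfolding mem_l_coset by blast
  qed
  note aR = ideal_subringE[OF principal_ideal_eq(2)[OF a]]
  have "\<exists>y\<in>a <# R. horner K w c n = w [^] n \<oplus> y"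
  proof (rule horner_minus_power[OF _ aR(2,3) _ _ c])
    show "a <# R \<subseteq> carrier K" using aR(1) R_carrier by blast
    show "u \<otimes> w \<in> a <# R" if "u \<in> a <# R" for u
    proof -
      have "u \<in> R" using aR(1) that by blast
      then show ?thesis using aR(4)[OF wR that] m_comm[of u w] R_carrier wR by simp
    qed
  qed (use w in auto)
  then obtain r where r: "r \<in> R" "w [^] n \<oplus> a \<otimes> r = \<zero>" using nc(3) by (auto simp: mem_l_coset)
  have rc: "r \<in> carrier K" "w [^] n \<in> carrier K" using r R_carrier w by auto
  then have "w [^] n = \<ominus> (a \<otimes> r)" using r(2) ac minus_equality[of "w [^] n" "a \<otimes> r"] by simp
  then have "w [^] n = a \<otimes> \<ominus> r" using ac rc by (simp add: r_minus)
  then have "a \<otimes> \<ominus> r \<in> Units K" using Units_pow_closed[OF w(2), of n] by simp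
  then show ?thesis by (rule Units_of_mult(1)[OF ac a_inv_closed[OF rc(1)]])
qed

lemma krull_dim_R: "krull_dim (subring_of K R) = 1"
  using arf by (simp add: arf_ring_def)

lemma closed_ideal_principal:
  "I \<in> closed_regular_ideals (subring_of K R) \<Longrightarrow>
    \<exists>a\<in>I. I = ideal_closure (subring_of K R) (genideal (subring_of K R) {a})"
  using arf by (simp add: arf_ring_def)

section \<open>Stable elements and the maximal ideal of \<open>ext_ring t\<close>\<close>

text \<open>The invariant of the construction: \<open>t <# ext_ring t\<close> is integrally closed
  in \<open>R\<close>. The reverse inclusion holds for every ideal.\<close>

definition stable :: "'a \<Rightarrow> bool" where
  "stable t \<longleftrightarrow> t \<in> R \<and> t \<in> Units K \<and>
     ideal_closure (subring_of K R) (t <# ext_ring t) \<subseteq> t <# ext_ring t"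

lemma stable_one: "stable \<one>"
proof -
  have "\<one> <# R = R" using R_carrier by (force simp: l_coset_def)
  then show ?thesis using closure_subset R_simps by (simp add: stable_def ext_ring_one)
qed

text \<open>The first Arf condition is applied to \<open>J\<close>, which is \<open>t\<close> times
  the maximal ideal of \<open>ext_ring t\<close>; \<open>w\<close> provides the regular element
  \<open>t \<otimes> w\<close> of \<open>J\<close>. The resulting generator \<open>a\<close> is
  \<open>t \<otimes> b\<close> with \<open>b\<close> in that maximal ideal, and since
  \<open>J = a <# ext_ring a\<close>, the integral closedness of \<open>J\<close> is the stability
  of \<open>a\<close>.\<close>

lemma stable_step:
  assumes t: "stable t" and w: "w \<in> R" "w \<in> N" "w \<in> Units K"
  obtains b where "b \<in> Units K" "b \<in> N" "stable (t \<otimes> b)" "ext_ring t \<subseteq> ext_ring (t \<otimes> b)"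
    "ext_ring t \<inter> N = b <# ext_ring (t \<otimes> b)"
proof -
  have tR: "t \<in> R" "t \<in> Units K" "t \<in> carrier K" using t by (auto simp: stable_def)
  note A = subring_ext_ring[OF tR(1,2)]
  note A_simps = subringE(2,3,5,6,7)[OF A]
  have RA: "R \<subseteq> ext_ring t" by (rule subset_ext_ring[OF tR(1,2)])
  define J where "J = t <# (ext_ring t \<inter> N)"
  have J_iff: "x \<in> J \<longleftrightarrow> (\<exists>z. z \<in> ext_ring t \<and> z \<in> N \<and> x = t \<otimes> z)" for x
    by (auto simp: J_def mem_l_coset)
  have JR: "J \<subseteq> R" by (auto simp: J_iff ext_ring_def)
  interpret R: cring "subring_of K R" by (rule cring_R)
  have J_ideal: "ideal J (subring_of K R)"
  proof (rule ideal_subringI[OF subring_R JR])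
    have "\<zero> = t \<otimes> \<zero>" using tR by simp
    then show "\<zero> \<in> J" unfolding J_iff using N_simps(2) A_simps(1) by blast
  next
    fix x y assume "x \<in> J" "y \<in> J"
    then obtain u v where uv: "u \<in> ext_ring t" "u \<in> N" "x = t \<otimes> u" "v \<in> ext_ring t" "v \<in> N" "y = t \<otimes> v"
      unfolding J_iff by blast
    then have "x \<oplus> y = t \<otimes> (u \<oplus> v)" using tR N_carrier by (simp add: r_distr)
    then show "x \<oplus> y \<in> J" unfolding J_iff using uv A_simps(5) N_simps(3) by blast
  next
    fix a x assume a: "a \<in> R" and "x \<in> J"
    then obtain u where u: "u \<in> ext_ring t" "u \<in> N" "x = t \<otimes> u" unfolding J_iff by blast
    then have "a \<otimes> x = t \<otimes> (a \<otimes> u)" using tR N_carrier R_carrier a by (simp add: m_lcomm)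
    moreover have "a \<otimes> u \<in> ext_ring t" "a \<otimes> u \<in> N"
      using a u A_simps(4) RA N_simps(4) R_subset_B by blast+
    ultimately show "a \<otimes> x \<in> J" unfolding J_iff by blast
  qed
  have J_closed: "ideal_closure (subring_of K R) J = J"
  proof
    show "J \<subseteq> ideal_closure (subring_of K R) J" by (rule R.ideal_closure_superset[OF J_ideal])
    show "ideal_closure (subring_of K R) J \<subseteq> J"
    proof
      fix x assume x: "x \<in> ideal_closure (subring_of K R) J"
      have "J \<subseteq> t <# ext_ring t" by (auto simp: J_iff mem_l_coset)
      then have "x \<in> t <# ext_ring t" using ideal_closure_mono x t unfolding stable_def by blast
      then obtain z where z: "z \<in> ext_ring t" "x = t \<otimes> z" by (auto simp: mem_l_coset)
      have zB: "z \<in> B" and zc: "z \<in> carrier K" using z ext_ring_subset B_carrier by auto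
      \<comment> \<open>Dividing the equation of \<open>t \<otimes> z\<close> by a power of
        \<open>t\<close> leaves coefficients in \<open>N\<close>. Then a power of \<open>z\<close>
        is in \<open>N\<close>, and so is \<open>z\<close>.\<close>
      have "\<exists>n e. n > 0 \<and> e \<in> {1..n} \<rightarrow> N \<and> horner K z e n = \<zero>"
      proof (rule closure_scale[OF tR(2) JR])
        show "J \<subseteq> t <# N" by (auto simp: J_iff mem_l_coset)
        show "N \<subseteq> carrier K" using N_carrier by blast
        show "t \<otimes> z \<in> ideal_closure (subring_of K R) J" using x z by simp
        show "u \<otimes> v \<in> N" if "u \<in> N" "v \<in> N" for u v using N_simps(4) N_B that by blast
        show "r \<otimes> v \<in> N" if "r \<in> R" "v \<in> N" for r v using N_simps(4) R_subset_B that by blast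
      qed (use N_simps(3) zc in auto)
      then obtain n e where ne: "n > 0" "e \<in> {1..n} \<rightarrow> N" "horner K z e n = \<zero>" by blast
      have "\<exists>y\<in>N. horner K z e n = z [^] n \<oplus> y"
      proof (rule horner_minus_power[OF _ N_simps(2,3) _ zc ne(2)])
        show "N \<subseteq> carrier K" using N_carrier by blast
        show "u \<otimes> z \<in> N" if "u \<in> N" for u
          using N_simps(4)[OF zB that] m_comm[of u z] zc N_carrier[OF that] by simp
      qed auto
      then obtain y where y: "y \<in> N" "z [^] n \<oplus> y = \<zero>" using ne(3) by auto
      then have "z [^] n = \<ominus> y" using zc N_carrier minus_equality[of "z [^] n" y] by simp
      then have "z [^] n \<in> N" using N_minus y by simp
      then have "z \<in> N" using power_notin_N[OF zB] by blast
      then show "x \<in> J" using z unfolding J_iff by blast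
    qed
  qed
  have wJ: "t \<otimes> w \<in> J" using w RA unfolding J_iff by blast
  have tw: "t \<otimes> w \<in> Units K" using tR w by simp
  then have "t \<otimes> w \<in> nonzerodivisors (subring_of K R)"
    using nonzerodivisor_if_Units wJ JR by blast
  then have "J \<in> closed_regular_ideals (subring_of K R)"
    using J_ideal J_closed wJ by (auto simp: closed_regular_ideals_def)
  then obtain a where a: "a \<in> J" "J = ideal_closure (subring_of K R) (genideal (subring_of K R) {a})"
    using closed_ideal_principal by blast
  have aR: "a \<in> R" using a JR by blast
  have aU: "a \<in> Units K" using Units_if_regular_mem_closure[OF aR _ tw] wJ a(2) by blast
  have JB: "J = R \<inter> (a <# B)" using a(2) closure_principal[OF aR aU] by simp
  obtain b where b: "b \<in> ext_ring t" "b \<in> N" "a = t \<otimes> b" using a(1) unfolding J_iff by blast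
  have bc: "b \<in> carrier K" using b N_carrier by blast
  have bU: "b \<in> Units K" using Units_of_mult(2)[OF tR(3) bc] aU b by simp
  \<comment> \<open>Here \<open>a \<otimes> z = t \<otimes> (b \<otimes> z)\<close>, and
    \<open>b\<close> itself belongs to the ring \<open>ext_ring t\<close>.\<close>
  have sub: "ext_ring t \<subseteq> ext_ring a"
  proof
    fix z assume z: "z \<in> ext_ring t"
    then have zc: "z \<in> carrier K" "z \<in> B" using ext_ring_subset B_carrier by auto
    have "b \<otimes> z \<in> ext_ring t" using A_simps(4) b z by blast
    then have "a \<otimes> z \<in> R" using b tR bc zc by (simp add: ext_ring_def m_assoc)
    then show "z \<in> ext_ring a" using zc by (simp add: ext_ring_def)
  qed
  \<comment> \<open>This is the equality \<open>J = R \<inter> (a <# B)\<close> divided by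
    \<open>t\<close>.\<close>
  have eq: "ext_ring t \<inter> N = b <# ext_ring a"
  proof
    show "ext_ring t \<inter> N \<subseteq> b <# ext_ring a"
    proof
      fix z assume z: "z \<in> ext_ring t \<inter> N"
      then have "t \<otimes> z \<in> J" unfolding J_iff by blast
      then have "t \<otimes> z \<in> R \<inter> (a <# B)" using JB by simp
      then obtain s where s: "s \<in> B" "t \<otimes> z = a \<otimes> s" "a \<otimes> s \<in> R"
        unfolding Int_iff mem_l_coset by metis
      have "t \<otimes> z = t \<otimes> (b \<otimes> s)" using s b tR bc B_carrier by (simp add: m_assoc)
      then have "z = b \<otimes> s" using tR z N_carrier bc s B_carrier by simp
      then show "z \<in> b <# ext_ring a" using s unfolding mem_l_coset ext_ring_def by blast
    qed
    show "b <# ext_ring a \<subseteq> ext_ring t \<inter> N"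
    proof
      fix z assume "z \<in> b <# ext_ring a"
      then obtain s where s: "s \<in> B" "a \<otimes> s \<in> R" "z = b \<otimes> s" unfolding mem_l_coset ext_ring_def by auto
      have sc: "s \<in> carrier K" using s B_carrier by auto
      have "z \<in> N" using N_simps(4)[OF s(1) b(2)] s(3) sc bc m_comm[of s b] by simp
      moreover have "t \<otimes> z \<in> R" using s b tR bc sc by (simp add: m_assoc)
      ultimately show "z \<in> ext_ring t \<inter> N" using N_B by (simp add: ext_ring_def)
    qed
  qed
  have "J = a <# ext_ring a"
  proof -
    have "ext_ring a \<subseteq> carrier K" using ext_ring_subset B_carrier by blast
    then have "t <# (b <# ext_ring a) = a <# ext_ring a"
      using b tR bc by (force simp: l_coset_def m_assoc)
    then show ?thesis using eq J_def by simp
  qed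
  then have "stable a" using aR aU J_closed by (simp add: stable_def)
  then show thesis using that[OF bU b(2)] sub eq b(3) by simp
qed

section \<open>Powers of elements of \<open>N\<close>\<close>

lemma scale_B_minus: "c \<in> carrier K \<Longrightarrow> u \<in> c <# B \<Longrightarrow> v \<in> c <# B \<Longrightarrow> u \<ominus> v \<in> c <# B"
proof -
  assume c: "c \<in> carrier K" "u \<in> c <# B" "v \<in> c <# B"
  then obtain x y where xy: "x \<in> B" "y \<in> B" "u = c \<otimes> x" "v = c \<otimes> y" by (auto simp: mem_l_coset)
  then have "u \<ominus> v = c \<otimes> (x \<oplus> \<ominus> y)" using c B_carrier by (simp add: r_distr r_minus minus_eq)
  then show ?thesis using xy B_simps unfolding mem_l_coset by blast
qed

lemma scale_B_mult: "c \<in> carrier K \<Longrightarrow> u \<in> c <# B \<Longrightarrow> s \<in> B \<Longrightarrow> u \<otimes> s \<in> c <# B"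
proof -
  assume c: "c \<in> carrier K" "u \<in> c <# B" "s \<in> B"
  then obtain x where x: "x \<in> B" "u = c \<otimes> x" by (auto simp: mem_l_coset)
  then have "u \<otimes> s = c \<otimes> (x \<otimes> s)" using c B_carrier by (simp add: m_assoc)
  then show ?thesis using x c B_simps unfolding mem_l_coset by blast
qed

text \<open>Peel off the constant coefficient of an integral equation of \<open>z\<close>: if it lies in \<open>N\<close> it is
  a multiple of \<open>a\<close>, otherwise the remaining factor is a unit of \<open>B\<close>.\<close>

lemma power_in_scale_if_horner:
  assumes a: "a \<in> carrier K" "R \<inter> N \<subseteq> a <# B" and z: "z \<in> N" and c: "c \<in> {1..k} \<rightarrow> R"
    and "z [^] (j::nat) \<otimes> horner K z c k \<in> a <# B"
  shows "\<exists>e::nat. z [^] e \<in> a <# B"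
  using c assms(5)
proof (induction k arbitrary: j)
  case 0
  then show ?case using N_carrier[OF z] by auto
next
  case (Suc k)
  have zc: "z \<in> carrier K" and zB: "z \<in> B" using z N_carrier N_B by auto
  have c: "c \<in> {1..k} \<rightarrow> R" and r: "c (Suc k) \<in> R" using Suc.prems by auto
  have zj: "z [^] i \<in> B" for i :: nat using zB B_simps by (induction i) auto
  have "c \<in> {1..k} \<rightarrow> B" using c R_subset_B by auto
  then have "horner K z c k \<in> B"
    using cring.horner_closed[OF cring_closure, of c k z] zB by simp
  then have h: "horner K z c k \<in> B" "horner K z c k \<in> carrier K" using B_carrier by auto
  have rc: "c (Suc k) \<in> carrier K" "c (Suc k) \<in> B" using r R_carrier R_subset_B by auto
  have hz: "horner K z c k \<otimes> z \<in> N" using N_simps(4)[OF h(1) z] .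
  let ?p = "horner K z c (Suc k)"
  show ?case
  proof (cases "c (Suc k) \<in> N")
    case True
    \<comment> \<open>Once the constant coefficient is subtracted, a factor \<open>z\<close> moves
      from the polynomial to the power in front. This is why the induction is over arbitrary
      \<open>j\<close>.\<close>
    then have "c (Suc k) \<otimes> z [^] j \<in> a <# B" using r a zj scale_B_mult by blast
    then have "z [^] j \<otimes> ?p \<ominus> c (Suc k) \<otimes> z [^] j \<in> a <# B"
      using scale_B_minus[OF a(1) Suc.prems(2)] by blast
    moreover have "z [^] j \<otimes> ?p \<ominus> c (Suc k) \<otimes> z [^] j = z [^] Suc j \<otimes> horner K z c k"
      using zc rc h by (simp add: r_distr minus_eq a_assoc r_neg m_ac)
    ultimately show ?thesis using Suc.IH[OF c, of "Suc j"] by simp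
  next
    case False
    have pB: "?p \<in> B" using h rc zB B_simps by simp
    \<comment> \<open>Modulo \<open>N\<close> the value \<open>?p\<close> equals its constant
      coefficient, because \<open>z\<close> is in \<open>N\<close>.\<close>
    have "?p \<notin> N"
    proof
      assume "?p \<in> N"
      then have "?p \<oplus> \<ominus> (horner K z c k \<otimes> z) \<in> N" using hz N_minus N_simps(3) by blast
      moreover have "?p \<oplus> \<ominus> (horner K z c k \<otimes> z) = c (Suc k)"
        using h zc rc by (simp add: a_ac r_neg)
      ultimately show False using False by simp
    qed
    then have u: "?p \<in> Units K" "inv ?p \<in> B" using unit_B pB by blast+
    then have "z [^] j \<otimes> ?p \<otimes> inv ?p \<in> a <# B" using scale_B_mult[OF a(1) Suc.prems(2)] by blast
    moreover have "z [^] j \<otimes> ?p \<otimes> inv ?p = z [^] j"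
      using u zc Units_closed[OF u(1)] Units_r_inv[OF u(1)] m_assoc[of "z [^] j" ?p "inv ?p"]
      by (simp del: horner.simps)
    ultimately show ?thesis by auto
  qed
qed

text \<open>Two steps. By \<open>stable_step\<close> for \<open>\<one>\<close>, the maximal ideal of
  \<open>R\<close> lies in \<open>a <# B\<close> for some \<open>a\<close>, and an integral equation
  of \<open>z\<close> puts a power of \<open>z\<close> into \<open>a <# B\<close>. Since
  \<open>R\<close> has dimension one, a power of \<open>a\<close> lies in \<open>w R\<close> for a
  suitable \<open>w\<close> in \<open>y <# B\<close>.\<close>

lemma power_mem_scale:
  assumes w0: "w0 \<in> R" "w0 \<in> N" "w0 \<in> Units K" and z: "z \<in> N" and y: "y \<in> Units K"
  shows "\<exists>n::nat. z [^] n \<in> y <# B"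
proof -
  obtain a where a: "a \<in> Units K" "a \<in> N" "stable (\<one> \<otimes> a)" "ext_ring \<one> \<inter> N = a <# ext_ring (\<one> \<otimes> a)"
    using stable_step[OF stable_one w0] by metis
  have ac: "a \<in> carrier K" and aR: "a \<in> R" using a by (auto simp: stable_def)
  have RN: "R \<inter> N \<subseteq> a <# B"
    using a(4) ext_ring_subset[of "\<one> \<otimes> a"] unfolding ext_ring_one by (auto simp: l_coset_def)
  obtain k c where kc: "k > 0" "c \<in> {1..k} \<rightarrow> R" "horner K z c k = \<zero>"
    using N_B[OF z] unfolding mem_B_iff by auto
  have zc: "z \<in> carrier K" using z N_carrier by auto
  have "\<zero> = a \<otimes> \<zero>" using ac by simp
  then have "\<zero> \<in> a <# B" using B_simps(1) unfolding mem_l_coset by blast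
  then have "z [^] (0::nat) \<otimes> horner K z c k \<in> a <# B" using kc(3) zc by simp
  then obtain e :: nat where e: "z [^] e \<in> a <# B"
    using power_in_scale_if_horner[OF ac RN z kc(2)] by blast
  then obtain s where s: "s \<in> B" "z [^] e = a \<otimes> s" by (auto simp: mem_l_coset)
  have yc: "y \<in> carrier K" "inv y \<in> carrier K" using y by auto
  \<comment> \<open>Writing the inverse of \<open>y\<close> as a fraction with denominator
    \<open>w\<close> gives \<open>w = y \<otimes> r\<close>, a non-zerodivisor of \<open>R\<close>
    in \<open>y <# B\<close>.\<close>
  then obtain r w where rw: "r \<in> R" "w \<in> nonzerodivisors (subring_of K R)" "inv y = r \<otimes> inv w"
    using fractions unfolding total_ring_of_fractions_def by blast
  have w: "w \<in> R" "w \<in> Units K" "w \<in> carrier K" using Units_if_nonzerodivisor[OF rw(2)] by auto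
  have rc: "r \<in> carrier K" using rw R_carrier by auto
  have wy: "w = y \<otimes> r"
  proof -
    have "y \<otimes> r = y \<otimes> (r \<otimes> inv w) \<otimes> w" using yc rc w by (simp add: m_assoc)
    also have "\<dots> = w" using rw(3)[symmetric] y w by simp
    finally show ?thesis by simp
  qed
  interpret R: cring "subring_of K R" by (rule cring_R)
  note loc = local_intermediate[OF subring_R subset_refl R_subset_B]
  have "\<exists>n::nat. a [^]\<^bsub>subring_of K R\<^esub> n \<in> cgenideal (subring_of K R) w"
  proof (rule R.power_in_principal_if_krull_dim_le_one[where M = "R \<inter> N"])
    show "krull_dim (subring_of K R) \<le> 1" by (simp add: krull_dim_R)
    show "primeideal (R \<inter> N) (subring_of K R)" by (rule R.maximalideal_prime[OF loc(2)])
    show "w \<in> nonzerodivisors (subring_of K R)" by fact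
    show "a \<in> R \<inter> N" using aR a by blast
    fix P assume P: "primeideal P (subring_of K R)"
    note P_ideal = ideal_subringE[OF primeideal.axioms(1)[OF P]]
    have "x \<in> N" if x: "x \<in> P" for x
    proof (rule ccontr)
      assume xN: "x \<notin> N"
      have xR: "x \<in> R" using P_ideal(1) x by blast
      then have u: "x \<in> Units K" "inv x \<in> B" using unit_B xN R_subset_B by auto
      then have "inv x \<in> R" using inv_in_subring[OF subring_R subset_refl xR] by blast
      then have "inv x \<otimes> x \<in> P" using P_ideal(4) x by blast
      then have "\<one> \<in> P" using u by simp
      then have "P = R"
        using ideal.one_imp_carrier[OF primeideal.axioms(1)[OF P]] by simp
      then show False using primeideal.I_notcarr[OF P] by simp
    qed
    then show "P \<subseteq> R \<inter> N" using P_ideal(1) by blast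
  qed
  then obtain n :: nat and r' where n: "r' \<in> R" "a [^] n = r' \<otimes> w"
    by (auto simp: cgenideal_def nat_pow_consistent[symmetric])
  have sc: "s \<in> carrier K" "r' \<in> carrier K" using s n B_carrier R_carrier by auto
  have sn: "s [^] n \<in> B" using s(1) B_simps by (induction n) auto
  have "z [^] (e * n) = (z [^] e) [^] n" using nat_pow_pow[OF zc] by simp
  also have "\<dots> = a [^] n \<otimes> s [^] n" using s(2) sc ac nat_pow_distrib by simp
  also have "\<dots> = y \<otimes> (r \<otimes> r' \<otimes> s [^] n)" using n(2) wy yc rc sc by (simp add: m_ac)
  finally have "z [^] (e * n) = y \<otimes> (r \<otimes> r' \<otimes> s [^] n)" .
  moreover have "r \<otimes> r' \<otimes> s [^] n \<in> B" using rw(1) n(1) sn R_subset_B B_simps(4) by blast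
  ultimately show ?thesis unfolding mem_l_coset by blast
qed

section \<open>The quotients of the ideal \<open>I\<close>\<close>

context
  fixes I x
  assumes I: "ideal I (subring_of K R)" "I = R \<inter> (x <# B)"
    and x: "x \<in> R" "x \<in> Units K" and I_proper: "I \<noteq> R"
begin

text \<open>For a unit \<open>t\<close> this is \<open>I\<close> divided by \<open>t\<close>, formed
  in all of \<open>K\<close>; that it lies in \<open>ext_ring t\<close> is carried along as a
  separate hypothesis. For the parameters \<open>t\<close> of the tower these are the ideals of
  \<open>ideal_seq\<close>, as long as the recursion is followed.\<close>

definition div_ideal :: "'a \<Rightarrow> 'a set" where
  "div_ideal t = {z \<in> carrier K. t \<otimes> z \<in> I}"

lemmas I_simps = ideal_subringE[OF I(1)]

lemma x_carrier: "x \<in> carrier K" using x by auto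

lemma mem_IE: "u \<in> I \<Longrightarrow> u \<in> R \<and> (\<exists>s\<in>B. u = x \<otimes> s)"
  using I(2) by (auto simp: mem_l_coset)

lemma mem_II: "x \<otimes> s \<in> R \<Longrightarrow> s \<in> B \<Longrightarrow> x \<otimes> s \<in> I"
  unfolding I(2) mem_l_coset Int_iff by blast

lemma x_I: "x \<in> I"
  using mem_II[of \<one>] x x_carrier B_simps by simp

lemma one_notin_I: "\<one> \<notin> I"
proof
  assume "\<one> \<in> I"
  then have "r \<in> I" if "r \<in> R" for r using I_simps(4)[OF that] R_carrier[OF that] by fastforce
  then show False using I_simps(1) I_proper by blast
qed

text \<open>An element of \<open>I\<close> outside \<open>N\<close> would be a unit of
  \<open>R\<close>.\<close>

lemma I_N: "I \<subseteq> N"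
proof
  fix u assume u: "u \<in> I"
  show "u \<in> N"
  proof (rule ccontr)
    assume uN: "u \<notin> N"
    have uR: "u \<in> R" using u I_simps by blast
    then have v: "u \<in> Units K" "inv u \<in> B" using unit_B uN R_subset_B by auto
    then have "inv u \<in> R" using inv_in_subring[OF subring_R subset_refl uR] by blast
    then have "inv u \<otimes> u \<in> I" using I_simps(4) u by blast
    then show False using one_notin_I v by simp
  qed
qed

context
  fixes t assumes t: "t \<in> R" "t \<in> Units K" and div_sub: "div_ideal t \<subseteq> ext_ring t"
begin

text \<open>The product \<open>t \<otimes> (u \<otimes> v)\<close> is in \<open>R\<close> by the Arf
  condition and in \<open>x <# B\<close> because \<open>u\<close> is integral, hence in
  \<open>I\<close>.\<close>

lemma div_ideal_mult:
  assumes "u \<in> ext_ring t" "v \<in> div_ideal t"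
  shows "u \<otimes> v \<in> div_ideal t"
proof -
  have u: "u \<in> B" "t \<otimes> u \<in> R" "u \<in> carrier K" using assms B_carrier by (auto simp: ext_ring_def)
  have v: "v \<in> B" "t \<otimes> v \<in> I" "v \<in> carrier K" "t \<otimes> v \<in> R"
    using assms div_sub B_carrier I_simps(1) by (auto simp: ext_ring_def div_ideal_def)
  obtain s where s: "s \<in> B" "t \<otimes> v = x \<otimes> s" using mem_IE[OF v(2)] by blast
  have "t \<otimes> (u \<otimes> v) = u \<otimes> (t \<otimes> v)" using t u v Units_closed by (simp add: m_lcomm)
  also have "\<dots> = x \<otimes> (u \<otimes> s)" using s u x_carrier B_carrier by (simp add: m_lcomm)
  finally have e: "t \<otimes> (u \<otimes> v) = x \<otimes> (u \<otimes> s)" .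
  moreover have "t \<otimes> (u \<otimes> v) \<in> R" by (rule arf_mult[OF t u(1) v(1) u(2) v(4)])
  ultimately have "t \<otimes> (u \<otimes> v) \<in> I" using mem_II[of "u \<otimes> s"] B_simps(4)[OF u(1) s(1)] by simp
  then show ?thesis using u v by (simp add: div_ideal_def)
qed

text \<open>An element outside \<open>N\<close> would be a unit of \<open>ext_ring t\<close> and
  force equality with the whole ring.\<close>

lemma div_ideal_N:
  assumes "div_ideal t \<noteq> ext_ring t"
  shows "div_ideal t \<subseteq> ext_ring t \<inter> N"
proof
  fix u assume u: "u \<in> div_ideal t"
  have uA: "u \<in> ext_ring t" using u div_sub by blast
  have "u \<in> N"
  proof (rule ccontr)
    assume uN: "u \<notin> N"
    have v: "u \<in> Units K" "inv u \<in> B" using unit_B uN uA ext_ring_subset by auto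
    have "inv u \<in> ext_ring t"
      by (rule inv_in_subring[OF subring_ext_ring[OF t] subset_ext_ring[OF t] uA v])
    then have "inv u \<otimes> u \<in> div_ideal t" using div_ideal_mult u by blast
    then have one: "\<one> \<in> div_ideal t" using v by simp
    have "a \<in> div_ideal t" if "a \<in> ext_ring t" for a
    proof -
      have "a \<in> carrier K" using that ext_ring_subset B_carrier by blast
      then show ?thesis using div_ideal_mult[OF that one] by simp
    qed
    then show False using assms div_sub by blast
  qed
  then show "u \<in> ext_ring t \<inter> N" using uA by blast
qed

text \<open>One inclusion holds because \<open>N\<close> is radical. For the other,
  \<open>power_mem_scale\<close> brings a power of each element of \<open>N\<close> into
  \<open>(inv t \<otimes> x) <# B\<close>.\<close>

lemma radical_div_ideal:
  assumes "div_ideal t \<noteq> ext_ring t"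
  shows "ideal_radical (subring_of K (ext_ring t)) (div_ideal t) = ext_ring t \<inter> N"
proof
  note A_simps = subringE(2,3,5,6,7)[OF subring_ext_ring[OF t]]
  have tc: "t \<in> carrier K" using t by auto
  show "ideal_radical (subring_of K (ext_ring t)) (div_ideal t) \<subseteq> ext_ring t \<inter> N"
  proof
    fix z assume z: "z \<in> ideal_radical (subring_of K (ext_ring t)) (div_ideal t)"
    then obtain n :: nat where n: "z \<in> ext_ring t" "z [^] n \<in> div_ideal t"
      by (auto simp: ideal_radical_def nat_pow_consistent[symmetric])
    then have "z [^] n \<in> N" using div_ideal_N[OF assms] by blast
    then have "z \<in> N" using power_notin_N n(1) ext_ring_subset by blast
    then show "z \<in> ext_ring t \<inter> N" using n by blast
  qed
  show "ext_ring t \<inter> N \<subseteq> ideal_radical (subring_of K (ext_ring t)) (div_ideal t)"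
  proof
    fix z assume z: "z \<in> ext_ring t \<inter> N"
    \<comment> \<open>Chosen so that \<open>t \<otimes> ?y = x\<close>: then \<open>t\<close> times
      an element of \<open>?y <# B\<close> is in \<open>x <# B\<close>, and it is in
      \<open>I\<close> once it is in \<open>R\<close>.\<close>
    let ?y = "inv t \<otimes> x"
    have y: "?y \<in> Units K" "t \<otimes> ?y = x" using t x x_carrier tc by (simp_all add: m_assoc[symmetric])
    have "x \<in> N" using x_I I_N by blast
    then obtain n :: nat where "z [^] n \<in> ?y <# B"
      using power_mem_scale[OF x(1) _ x(2) _ y(1), of z] z by blast
    then obtain s where s: "s \<in> B" "z [^] n = ?y \<otimes> s" unfolding mem_l_coset by blast
    have zn: "z [^] n \<in> ext_ring t" using z A_simps by (induction n) auto
    have sc: "s \<in> carrier K" "?y \<in> carrier K" using s B_carrier y by auto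
    have "t \<otimes> z [^] n = x \<otimes> s" unfolding s(2) using m_assoc[OF tc sc(2,1)] y(2) by simp
    moreover have "t \<otimes> z [^] n \<in> R" using zn by (simp add: ext_ring_def)
    ultimately have "t \<otimes> z [^] n \<in> I" using mem_II s by simp
    then have "z [^] n \<in> div_ideal t"
      using zn ext_ring_subset B_carrier by (auto simp: div_ideal_def)
    then show "z \<in> ideal_radical (subring_of K (ext_ring t)) (div_ideal t)"
      using z by (auto simp: ideal_radical_def nat_pow_consistent[symmetric])
  qed
qed

text \<open>The colon is taken by \<open>b <# ext_ring (t \<otimes> b)\<close>. Testing it on
  \<open>b\<close> gives \<open>t \<otimes> b \<otimes> z \<in> I\<close>. Conversely, multiplying
  this element by some \<open>v\<close> in \<open>ext_ring (t \<otimes> b)\<close> stays in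
  \<open>R\<close>, since \<open>z\<close> and \<open>v\<close> lie in one ring, and in
  \<open>x <# B\<close>, since \<open>v\<close> is integral.\<close>

lemma div_ideal_step:
  assumes "div_ideal t \<noteq> ext_ring t"
    and b: "b \<in> Units K" "t \<otimes> b \<in> R" "ext_ring t \<inter> N = b <# ext_ring (t \<otimes> b)"
  shows "div_ideal (t \<otimes> b) \<subseteq> ext_ring (t \<otimes> b)"
    and "colon K (div_ideal t) (ext_ring t \<inter> N) = div_ideal (t \<otimes> b)"
proof -
  have c: "t \<in> carrier K" "b \<in> carrier K" using t b by auto
  have tb: "t \<otimes> b \<in> Units K" using t b by simp
  note A' = subring_ext_ring[OF b(2) tb]
  note A'_simps = subringE(2,3,5,6,7)[OF A']
  show sub: "div_ideal (t \<otimes> b) \<subseteq> ext_ring (t \<otimes> b)"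
  proof
    fix z assume "z \<in> div_ideal (t \<otimes> b)"
    then have z: "z \<in> carrier K" "(t \<otimes> b) \<otimes> z \<in> I" by (auto simp: div_ideal_def)
    then have "b \<otimes> z \<in> div_ideal t" using c by (simp add: div_ideal_def m_assoc)
    \<comment> \<open>A proper quotient lies in the maximal ideal, all of whose elements are
      divisible by \<open>b\<close> within \<open>ext_ring (t \<otimes> b)\<close>.\<close>
    then have "b \<otimes> z \<in> b <# ext_ring (t \<otimes> b)" using div_ideal_N[OF assms(1)] b(3) by blast
    then obtain s where s: "s \<in> ext_ring (t \<otimes> b)" "b \<otimes> z = b \<otimes> s" unfolding mem_l_coset by blast
    then have "z = s" using b(1) z(1) ext_ring_subset B_carrier by (metis Units_l_cancel subsetD)
    then show "z \<in> ext_ring (t \<otimes> b)" using s by simp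
  qed
  show "colon K (div_ideal t) (ext_ring t \<inter> N) = div_ideal (t \<otimes> b)"
  proof
    show "colon K (div_ideal t) (ext_ring t \<inter> N) \<subseteq> div_ideal (t \<otimes> b)"
    proof
      fix z assume z: "z \<in> colon K (div_ideal t) (ext_ring t \<inter> N)"
      have zc: "z \<in> carrier K" using z by (simp add: colon_def)
      have "b \<otimes> \<one> \<in> ext_ring t \<inter> N" unfolding b(3) mem_l_coset using A'_simps(2) by blast
      then have "z \<otimes> (b \<otimes> \<one>) \<in> div_ideal t" using z by (simp add: colon_def)
      then have "t \<otimes> (z \<otimes> b) \<in> I" using c by (simp add: div_ideal_def)
      then show "z \<in> div_ideal (t \<otimes> b)" using zc c by (simp add: div_ideal_def m_ac)
    qed
    show "div_ideal (t \<otimes> b) \<subseteq> colon K (div_ideal t) (ext_ring t \<inter> N)"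
    proof
      fix z assume z: "z \<in> div_ideal (t \<otimes> b)"
      then have zA: "z \<in> ext_ring (t \<otimes> b)" and zI: "(t \<otimes> b) \<otimes> z \<in> I" and zc: "z \<in> carrier K"
        using sub by (auto simp: div_ideal_def)
      obtain s where s: "s \<in> B" "(t \<otimes> b) \<otimes> z = x \<otimes> s" using mem_IE[OF zI] by blast
      have "z \<otimes> y \<in> div_ideal t" if y: "y \<in> ext_ring t \<inter> N" for y
      proof -
        obtain v where v: "v \<in> ext_ring (t \<otimes> b)" "y = b \<otimes> v" using y unfolding b(3) mem_l_coset by blast
        have vB: "v \<in> B" "v \<in> carrier K" using v ext_ring_subset B_carrier by auto
        have "z \<otimes> v \<in> ext_ring (t \<otimes> b)" using A'_simps(4) zA v by blast
        then have R: "(t \<otimes> b) \<otimes> (z \<otimes> v) \<in> R" by (simp add: ext_ring_def)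
        have "(t \<otimes> b) \<otimes> (z \<otimes> v) = (t \<otimes> b) \<otimes> z \<otimes> v" using c zc vB by (simp add: m_assoc)
        also have "\<dots> = x \<otimes> (s \<otimes> v)" using s vB x_carrier B_carrier by (simp add: m_assoc)
        finally have "(t \<otimes> b) \<otimes> (z \<otimes> v) = x \<otimes> (s \<otimes> v)" .
        then have "(t \<otimes> b) \<otimes> (z \<otimes> v) \<in> I" using mem_II R B_simps(4)[OF s(1) vB(1)] by simp
        moreover have "t \<otimes> (z \<otimes> y) = (t \<otimes> b) \<otimes> (z \<otimes> v)" using v(2) c zc vB by (simp add: m_ac)
        ultimately show ?thesis using v(2) c zc vB by (simp add: div_ideal_def)
      qed
      then show "z \<in> colon K (div_ideal t) (ext_ring t \<inter> N)" using zc by (simp add: colon_def)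
    qed
  qed
qed

end

end

end

section \<open>The tower of blowups\<close>

text \<open>Iteration of \<open>stable_step\<close> from \<open>\<one>\<close>; the same
  \<open>w\<close> serves at every step.\<close>

lemma (in arf_local) stable_sequence:
  assumes w: "w \<in> R" "w \<in> N" "w \<in> Units K"
  obtains T b where "T 0 = \<one>" "\<And>i. stable (T i)" "\<And>i. T (Suc i) = T i \<otimes> b i"
    "\<And>i. b i \<in> Units K" "\<And>i. ext_ring (T i) \<subseteq> ext_ring (T (Suc i))"
    "\<And>i. ext_ring (T i) \<inter> N = b i <# ext_ring (T (Suc i))"
proof -
  define Q where "Q t t' b \<longleftrightarrow> b \<in> Units K \<and> t' = t \<otimes> b \<and> ext_ring t \<subseteq> ext_ring t' \<and>
    ext_ring t \<inter> N = b <# ext_ring t'" for t t' b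
  \<comment> \<open>The clause for \<open>i = 0\<close> is part of the predicate because dependent
    choice leaves the first term free.\<close>
  have "\<exists>T. \<forall>i::nat. (stable (T i) \<and> (i = 0 \<longrightarrow> T i = \<one>)) \<and> (\<exists>b. Q (T i) (T (Suc i)) b)"
  proof (rule dependent_nat_choice)
    show "\<exists>t. stable t \<and> (0 = (0::nat) \<longrightarrow> t = \<one>)" using stable_one by blast
    fix t and n :: nat assume "stable t \<and> (n = 0 \<longrightarrow> t = \<one>)"
    then obtain b where "b \<in> Units K" "stable (t \<otimes> b)" "ext_ring t \<subseteq> ext_ring (t \<otimes> b)"
      "ext_ring t \<inter> N = b <# ext_ring (t \<otimes> b)" using stable_step[OF _ w] by metis
    then show "\<exists>t'. (stable t' \<and> (Suc n = 0 \<longrightarrow> t' = \<one>)) \<and> (\<exists>b. Q t t' b)"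
      unfolding Q_def by (intro exI[of _ "t \<otimes> b"]) auto
  qed
  then obtain T where T: "\<And>i. stable (T i)" "T 0 = \<one>" "\<And>i::nat. \<exists>b. Q (T i) (T (Suc i)) b" by blast
  from T(3) obtain b where "\<And>i. Q (T i) (T (Suc i)) (b i)" by metis
  then show thesis using that[of T b] T(1,2) unfolding Q_def by blast
qed

theorem theorem5p2:
  fixes K :: "('a, 'm) ring_scheme" and R I :: "'a set" and q :: nat
  assumes "total_ring_of_fractions K R"
    and "arf_ring K R"
    and "local_ring (subring_of K R)"
    and "local_ring (subring_of K (integral_closure K R))"
    and "I \<in> closed_regular_ideals (subring_of K R)"
    and "I \<noteq> R"
    and "{i. ideal_seq K R I i \<subset> ring_seq K R I i} = {0..q}"
  shows "(\<forall>i. local_ring (subring_of K (blowup_seq K R i)) \<and>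
              maximalideal (blowup_rad K R i) (subring_of K (blowup_seq K R i))) \<and>
         I = iterated_prod K (blowup_rad K R) q"
proof -
  interpret K: cring K using assms(1) by (simp add: total_ring_of_fractions_def)
  interpret B: cring "subring_of K (integral_closure K R)" using assms(4) by (simp add: local_ring_def)
  obtain N where N: "ideal N (subring_of K (integral_closure K R))" "\<one>\<^bsub>K\<^esub> \<notin> N"
    "\<And>x. x \<in> integral_closure K R \<Longrightarrow> x \<notin> N \<Longrightarrow> x \<in> Units (subring_of K (integral_closure K R))"
    using B.local_ringE[OF assms(4)] by auto
  interpret arf_local K R N
    by (intro arf_local.intro arf_local_axioms.intro K.is_cring assms(1,2) B.is_cring N)
  have I: "ideal I (subring_of K R)" "I \<inter> nonzerodivisors (subring_of K R) \<noteq> {}"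
    using assms(5) by (auto simp: closed_regular_ideals_def)
  obtain x where x: "x \<in> I" "I = ideal_closure (subring_of K R) (genideal (subring_of K R) {x})"
    using closed_ideal_principal[OF assms(5)] by blast
  \<comment> \<open>The regular element \<open>w\<close> of \<open>I\<close> shows that the
    generator \<open>x\<close> is a unit of \<open>K\<close>; as \<open>I\<close> lies in
    \<open>N\<close>, it also starts the tower.\<close>
  obtain w where w: "w \<in> I" "w \<in> R" "w \<in> Units K" using I(2) Units_if_nonzerodivisor by blast
  have xR: "x \<in> R" using x(1) K.ideal_subringE(1)[OF I(1)] by blast
  have xU: "x \<in> Units K" using Units_if_regular_mem_closure[OF xR _ w(3)] w(1) x(2) by blast
  have Ix: "I = R \<inter> (x <#\<^bsub>K\<^esub> B)" using x(2) closure_principal[OF xR xU] by simp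
  note I_ctxt = I(1) Ix xR xU assms(6)
  have wN: "w \<in> N" using I_N[OF I_ctxt] w(1) by blast
  obtain T b where T: "T 0 = \<one>\<^bsub>K\<^esub>" "\<And>i. stable (T i)" "\<And>i. T (Suc i) = T i \<otimes>\<^bsub>K\<^esub> b i"
    "\<And>i. b i \<in> Units K" "\<And>i. ext_ring (T i) \<subseteq> ext_ring (T (Suc i))"
    "\<And>i. ext_ring (T i) \<inter> N = b i <#\<^bsub>K\<^esub> ext_ring (T (Suc i))"
    using stable_sequence[OF w(2) wN w(3)] by metis
  have T_R: "T i \<in> R" "T i \<in> Units K" for i using T(2) by (auto simp: stable_def)
  let ?A = "\<lambda>i. ext_ring (T i)"
  have A: "subring (?A i) K" "R \<subseteq> ?A i" "?A i \<subseteq> B" for i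
    using subring_ext_ring subset_ext_ring T_R ext_ring_subset by auto
  note loc = local_intermediate[OF A]
  \<comment> \<open>The Jacobson radical of \<open>?A i\<close> is \<open>b i <# ?A (Suc i)\<close>,
    so its blowup is \<open>?A (Suc i)\<close>.\<close>
  have seq: "blowup_seq K R i = ?A i" for i
  proof (induction i)
    case 0
    show ?case using ext_ring_one T(1) by simp
  next
    case (Suc i)
    show ?case
      using K.blowup_ring_scale[OF A(1)[of i] A(1)[of "Suc i"] T(5) T(4), of i] T(6)[of i]
      by (simp add: Suc loc(3))
  qed
  have rad: "blowup_rad K R i = ?A i \<inter> N" for i unfolding seq by (rule loc(3))
  \<comment> \<open>The index is shifted by one: the \<open>n\<close>-th radical is a multiple of
    the next ring, so the product ends in \<open>?A (Suc n)\<close>.\<close>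
  have prod: "iterated_prod K (blowup_rad K R) n = T (Suc n) <#\<^bsub>K\<^esub> ?A (Suc n)" for n
  proof (induction n)
    case 0
    have "T (Suc 0) = b 0" using T(1) T(3)[of 0] K.Units_closed[OF T(4)[of 0]] by simp
    then show ?case using T(6)[of 0] by (simp add: rad)
  next
    case (Suc n)
    have "iterated_prod K (blowup_rad K R) (Suc n)
        = ideal_prod K (T (Suc n) <#\<^bsub>K\<^esub> ?A (Suc n)) (b (Suc n) <#\<^bsub>K\<^esub> ?A (Suc (Suc n)))"
      unfolding iterated_prod.simps(2) Suc rad[of "Suc n"] T(6)[of "Suc n"] ..
    also have "\<dots> = (T (Suc n) \<otimes>\<^bsub>K\<^esub> b (Suc n)) <#\<^bsub>K\<^esub> ?A (Suc (Suc n))"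
      by (rule K.ideal_prod_scale[OF A(1) T(5) subringE(3)[OF A(1)]])
        (use K.Units_closed T_R(2) T(4) in blast)+
    finally show ?case unfolding T(3)[of "Suc n"] .
  qed
  let ?J = "\<lambda>i. div_ideal I (T i)"
  \<comment> \<open>Passing from \<open>i\<close> to \<open>Suc i\<close> requires the
    \<open>i\<close>-th ideal to be proper, which holds up to \<open>q\<close>. Hence the
    description reaches \<open>Suc q\<close>, where properness fails.\<close>
  have pairs: "ring_ideal_seq K R I i = (?A i, ?J i) \<and> ?J i \<subseteq> ?A i" if "i \<le> Suc q" for i
    using that
  proof (induction i)
    case 0
    have "?J 0 = I"
      using K.ideal_subringE(1)[OF I(1)] R_carrier by (auto simp: T(1) div_ideal_def[OF I_ctxt])
    then show ?case
      using K.ideal_subringE(1)[OF I(1)] by (simp add: T(1) ext_ring_one)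
  next
    case (Suc i)
    then have IH: "ring_ideal_seq K R I i = (?A i, ?J i)" "?J i \<subseteq> ?A i" by auto
    have "i \<in> {i. ideal_seq K R I i \<subset> ring_seq K R I i}" unfolding assms(7) using Suc.prems by simp
    then have "?J i \<subset> ?A i" using IH(1) by simp
    then have ne: "?J i \<noteq> ?A i" by auto
    note ctxt = I_ctxt T_R[of i] IH(2) ne
    have TT: "T i \<otimes>\<^bsub>K\<^esub> b i \<in> R" using T_R(1)[of "Suc i"] T(3) by simp
    note step = div_ideal_step[OF ctxt T(4)[of i] TT T(6)[of i, unfolded T(3)]]
    have "colon K (?A i \<inter> N) (?A i \<inter> N) = ?A (Suc i)"
      unfolding T(6) by (rule K.colon_scale[OF A(1) T(4)])
    then show ?case
      using step IH(1) radical_div_ideal[OF ctxt] by (simp add: T(3))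
  qed
  have "\<not> ?J (Suc q) \<subset> ?A (Suc q)"
  proof
    assume "?J (Suc q) \<subset> ?A (Suc q)"
    then have "Suc q \<in> {i. ideal_seq K R I i \<subset> ring_seq K R I i}" using pairs[of "Suc q"] by simp
    then show False unfolding assms(7) by simp
  qed
  \<comment> \<open>At \<open>Suc q\<close> the ideal is contained in the ring but not properly, so
    the two agree.\<close>
  then have eq: "?J (Suc q) = ?A (Suc q)" using pairs[of "Suc q"] by blast
  have TU: "T (Suc q) \<in> Units K" by (rule T_R)
  have "I = T (Suc q) <#\<^bsub>K\<^esub> ?J (Suc q)"
  proof
    show "T (Suc q) <#\<^bsub>K\<^esub> ?J (Suc q) \<subseteq> I" by (auto simp: l_coset_def div_ideal_def[OF I_ctxt])
    show "I \<subseteq> T (Suc q) <#\<^bsub>K\<^esub> ?J (Suc q)"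
    proof
      fix u assume u: "u \<in> I"
      then have uc: "u \<in> carrier K" using K.ideal_subringE(1)[OF I(1)] R_carrier by blast
      let ?z = "inv\<^bsub>K\<^esub> T (Suc q) \<otimes>\<^bsub>K\<^esub> u"
      have z: "T (Suc q) \<otimes>\<^bsub>K\<^esub> ?z = u" "?z \<in> carrier K"
        using TU uc K.Units_closed[OF TU] K.m_assoc[of "T (Suc q)" "inv\<^bsub>K\<^esub> T (Suc q)" u] by simp_all
      then have "?z \<in> ?J (Suc q)" using u by (simp add: div_ideal_def[OF I_ctxt])
      then show "u \<in> T (Suc q) <#\<^bsub>K\<^esub> ?J (Suc q)" unfolding mem_l_coset using z(1)[symmetric] by blast
    qed
  qed
  then have "I = iterated_prod K (blowup_rad K R) q" using eq prod by simp
  moreover have "local_ring (subring_of K (blowup_seq K R i)) \<and>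
      maximalideal (blowup_rad K R i) (subring_of K (blowup_seq K R i))" for i
    unfolding rad unfolding seq using loc(1,2) by blast
  ultimately show ?thesis by blast
qed

end
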